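(* Consider the stationary two-queue tandem $GI/G/1\to\cdot/G/1$ described in the context, with generic independent inter-arrival time $X$ and service times $Y$ (first queue) and $Z$ (second queue), put $(U,V):=(Y-X,\,Z-X)$, and assume $\mathbb{P}(U>0)>0$ and $\mathbb{P}(V>0)>0$. Let $\psi(u,v):=\mathbb{P}(T^1_1\le u,\ T^2_1\le v)$ for $(u,v)\in\overline{\mathbb{R}}^2$, where, with $(U_1,V_1),(U_2,V_2),\ldots$ i.i.d. copies of $(U,V)$, $$T^1_1:=\sup_{1\le i<\infty}(U_1+\cdots+U_i),\qquad T^2_1:=\sup_{1\le i<j<\infty}(V_1+\cdots+V_i+U_{i+1}+\cdots+U_j).$$ Let $\gamma:\overline{\mathbb{R}}^2\to(-\infty,K_\gamma]$ ($K_\gamma$ finite) satisfy $\gamma(\infty,\infty):=\limsup_{u,v\to\infty}\gamma(u,v)=1$ and $$\mathbb{E}\left[\mathbf{1}_{\{u\ge U\}}\gamma\big((u-U)\wedge(v-V),v-V\big)\right]\ge\gamma(u,v)\quad\text{for all }(u,v)\in\operatorname{supp}(\gamma\vee 0),$$ and let $\eta:\overline{\mathbb{R}}^2\to[0,\infty)$ satisfy $\eta(\infty,\infty):=\liminf_{u,v\to\infty}\eta(u,v)=1$ and $$\mathbb{E}\left[\mathbf{1}_{\{u\ge U\}}\eta\big((u-U)\wedge(v-V),v-V\big)\right]\le\eta(u,v)\quad\text{for all }(u,v)\in\operatorname{supp}(\psi)\text{ with }v\ge u.$$ Then for all $x\ge 0$ the stationary waiting time $W$ (the waiting time of job $n$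 as $n\to\infty$) satisfies $$1-\mathbb{E}\left[\eta(x-(Z-Y)_+,\,x-(Z-Y))\right]\le\mathbb{P}(W>x)=1-\mathbb{E}\left[\psi(x-(Z-Y)_+,\,x-(Z-Y))\right]\le 1-\mathbb{E}\left[\gamma(x-(Z-Y)_+,\,x-(Z-Y))\right],$$ and the corresponding stationary sojourn time $D$ satisfies $$\begin{aligned}&1-\mathbb{E}\left[\mathbf{1}_{\{Z_1+Y<x\}}\,\eta(x-(Z_1+Z_2\vee Y),\,x-(Z_1+Z_2))\right]\\&\quad\le\mathbb{P}(D>x)=1-\mathbb{E}\left[\mathbf{1}_{\{Z_1+Y<x\}}\,\psi(x-(Z_1+Z_2\vee Y),\,x-(Z_1+Z_2))\right]\\&\quad\le 1-\mathbb{E}\left[\mathbf{1}_{\{Z_1+Y<x\}}\,\gamma(x-(Z_1+Z_2\vee Y),\,x-(Z_1+Z_2))\right],\end{aligned}$$ where $Z_1,Z_2$ are i.i.d. copies of $Z$, independent of $Y$.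
   Context: Model: jobs $0,1,2,\ldots$ traverse two FIFO single-server queues of infinite capacity in series. Job $0$ arrives at time $0$ and job $n$ at time $A_n:=X_0+\cdots+X_{n-1}$; its service times at the first and second queue are $Y_n$ and $Z_{n+1}$. The sequences $(X_n),(Y_n),(Z_n)$ of non-negative random variables are each i.i.d. (with generic variables $X,Y,Z$) and mutually independent. Departure times: $E^1_n=\max\{A_n,E^1_{n-1}\}+Y_n$ and $E^2_n=\max\{E^1_n,E^2_{n-1}\}+Z_{n+1}$, with $E^1_{-1}=E^2_{-1}=0$. The sojourn time of job $n$ is $D_n:=E^2_n-A_n$ and its (end-to-end) waiting time is $W_n:=D_n-Y_n-Z_{n+1}$. Stability is assumed: $\mathbb{E}[X]>\max\{\mathbb{E}[Y],\mathbb{E}[Z]\}$; service times are light-tailed, i.e. $\mathbb{E}[e^{\theta Y}]<\infty$ and $\mathbb{E}[e^{\theta Z}]<\infty$ for some $\theta>0$. $W$ and $D$ denote the limits in distribution of $W_n$ and $D_n$ as $n\to\infty$, with $\mathbb{P}(W>x)=\lim_n\mathbb{P}(W_n>x)$ and $\mathbb{P}(D>x)=\lim_n\mathbb{P}(D_n>x)$. Notation: $\overline{\mathbb{R}}:=\mathbb{R}\cup\{\pm\infty\}$; $u_+:=\max\{u,0\}$; $u\wedge v:=\min\{u,v\}$; $u\vee v:=\max\{u,v\}$ (so $Z_1+Z_2\vee Y=Z_1+\max\{Z_2,Y\}$); $\operatorname{supp}(\phi):=\{x:\phi(x)\ne0\}$ and $\operatorname{supp}(\phi\vee0):=\{x:\phi(x)>0\}$.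 All functions are Borel measurable; limits as $u,v\to\infty$ are taken over $(u,v)\in\overline{\mathbb{R}}^2$, $(u,v)\to(\infty,\infty)$.
   Formalization: In the sojourn-time chain the indicator of {Z_1+Y<x} is replaced by that of {Z_1+Y≤x}, as the printed equality and lower bound fail if Z_1+Y has an atom at x (e.g. Y=Z=1, X∈{0,2}, x=2); the strict form is kept when P(Z_1+Y=x)=0, and for the upper bound always. *)

theory Defs
  imports "HOL-Probability.Probability"
begin

text \<open>
  Two FIFO single-server queues in series. The sequences are indexed from 0; the entry
  \<open>Z 0\<close> is never used by the queueing recursion, since job \<open>n\<close> brings the service times
  \<open>Y n\<close> and \<open>Z (n + 1)\<close>. The mean of the inter-arrival time is allowed to be infinite,
  so the stability condition is stated in \<^typ>\<open>ennreal\<close>.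
\<close>

locale tandem_queue = prob_space M
  for M :: "'a measure" +
  fixes X Y Z :: "nat \<Rightarrow> 'a \<Rightarrow> real"
  assumes indep: "indep_vars (\<lambda>_. borel) (case_sum X (case_sum Y Z)) UNIV"
    and ident_X: "\<And>m n. distr M borel (X m) = distr M borel (X n)"
    and ident_Y: "\<And>m n. distr M borel (Y m) = distr M borel (Y n)"
    and ident_Z: "\<And>m n. distr M borel (Z m) = distr M borel (Z n)"
    and nonneg_X: "\<And>n. AE \<omega> in M. 0 \<le> X n \<omega>"
    and nonneg_Y: "\<And>n. AE \<omega> in M. 0 \<le> Y n \<omega>"
    and nonneg_Z: "\<And>n. AE \<omega> in M. 0 \<le> Z n \<omega>"
    and stable: "(\<integral>\<^sup>+ \<omega>. ennreal (X 1 \<omega>) \<partial>M)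
      > max (\<integral>\<^sup>+ \<omega>. ennreal (Y 1 \<omega>) \<partial>M) (\<integral>\<^sup>+ \<omega>. ennreal (Z 1 \<omega>) \<partial>M)"
    and light_tailed: "\<exists>\<theta>>0. integrable M (\<lambda>\<omega>. exp (\<theta> * Y 1 \<omega>))
      \<and> integrable M (\<lambda>\<omega>. exp (\<theta> * Z 1 \<omega>))"

definition arrival :: "(nat \<Rightarrow> 'a \<Rightarrow> real) \<Rightarrow> nat \<Rightarrow> 'a \<Rightarrow> real" where
  "arrival X n \<omega> = (\<Sum>k<n. X k \<omega>)"

text \<open>The \<open>0\<close> inside the maxima of the base cases is the departure time of the
  fictitious job \<open>-1\<close>.\<close>

primrec departure1 :: "(nat \<Rightarrow> 'a \<Rightarrow> real) \<Rightarrow> (nat \<Rightarrow> 'a \<Rightarrow> real) \<Rightarrow> nat \<Rightarrow> 'a \<Rightarrow> real" where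
  "departure1 X Y 0 = (\<lambda>\<omega>. max (arrival X 0 \<omega>) 0 + Y 0 \<omega>)"
| "departure1 X Y (Suc n) =
    (\<lambda>\<omega>. max (arrival X (Suc n) \<omega>) (departure1 X Y n \<omega>) + Y (Suc n) \<omega>)"

primrec departure2 ::
  "(nat \<Rightarrow> 'a \<Rightarrow> real) \<Rightarrow> (nat \<Rightarrow> 'a \<Rightarrow> real) \<Rightarrow> (nat \<Rightarrow> 'a \<Rightarrow> real) \<Rightarrow> nat \<Rightarrow> 'a \<Rightarrow> real" where
  "departure2 X Y Z 0 = (\<lambda>\<omega>. max (departure1 X Y 0 \<omega>) 0 + Z 1 \<omega>)"
| "departure2 X Y Z (Suc n) =
    (\<lambda>\<omega>. max (departure1 X Y (Suc n) \<omega>) (departure2 X Y Z n \<omega>) + Z (Suc (Suc n)) \<omega>)"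

definition sojourn_time ::
  "(nat \<Rightarrow> 'a \<Rightarrow> real) \<Rightarrow> (nat \<Rightarrow> 'a \<Rightarrow> real) \<Rightarrow> (nat \<Rightarrow> 'a \<Rightarrow> real) \<Rightarrow> nat \<Rightarrow> 'a \<Rightarrow> real" where
  "sojourn_time X Y Z n \<omega> = departure2 X Y Z n \<omega> - arrival X n \<omega>"

definition waiting_time ::
  "(nat \<Rightarrow> 'a \<Rightarrow> real) \<Rightarrow> (nat \<Rightarrow> 'a \<Rightarrow> real) \<Rightarrow> (nat \<Rightarrow> 'a \<Rightarrow> real) \<Rightarrow> nat \<Rightarrow> 'a \<Rightarrow> real" where
  "waiting_time X Y Z n \<omega> = sojourn_time X Y Z n \<omega> - Y n \<omega> - Z (Suc n) \<omega>"

definition limit_law :: "'a measure \<Rightarrow> (nat \<Rightarrow> 'a \<Rightarrow> real) \<Rightarrow> real measure \<Rightarrow> bool" where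
  "limit_law M S \<mu> \<longleftrightarrow>
    real_distribution \<mu> \<and> weak_conv_m (\<lambda>n. distr M borel (S n)) \<mu>"

definition T1 :: "(nat \<Rightarrow> 'a \<Rightarrow> real) \<Rightarrow> 'a \<Rightarrow> ereal" where
  "T1 U \<omega> = (SUP i\<in>{1..}. ereal (\<Sum>k=1..i. U k \<omega>))"

definition T2 :: "(nat \<Rightarrow> 'a \<Rightarrow> real) \<Rightarrow> (nat \<Rightarrow> 'a \<Rightarrow> real) \<Rightarrow> 'a \<Rightarrow> ereal" where
  "T2 U V \<omega> = (SUP (i, j)\<in>{(i, j). 1 \<le> i \<and> i < j}.
     ereal ((\<Sum>k=1..i. V k \<omega>) + (\<Sum>k=i+1..j. U k \<omega>)))"

definition joint_cdf_T ::
  "'a measure \<Rightarrow> (nat \<Rightarrow> 'a \<Rightarrow> real) \<Rightarrow> (nat \<Rightarrow> 'a \<Rightarrow> real) \<Rightarrow> ereal \<times> ereal \<Rightarrow> real" where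
  "joint_cdf_T M U V = (\<lambda>(u, v). measure M {\<omega> \<in> space M. T1 U \<omega> \<le> u \<and> T2 U V \<omega> \<le> v})"

definition supp :: "('b \<Rightarrow> real) \<Rightarrow> 'b set" where
  "supp \<phi> = {p. \<phi> p \<noteq> 0}"

text \<open>
  Expectation with values in the extended reals. The Bochner integral is \<open>0\<close> for
  non-integrable functions, whereas the functions below are only bounded on one side and
  their expectation may be infinite. At least one of the two parts is finite whenever this
  is applied to a function that is bounded from above or from below, so the
  convention for \<open>\<infinity> - \<infinity>\<close> is irrelevant.
\<close>

definition ext_expectation :: "'a measure \<Rightarrow> ('a \<Rightarrow> real) \<Rightarrow> ereal" where
  "ext_expectation M f =
    enn2ereal (\<integral>\<^sup>+ \<omega>. ennreal (f \<omega>) \<partial>M) - enn2ereal (\<integral>\<^sup>+ \<omega>. ennreal (- f \<omega>) \<partial>M)"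

lemma ext_expectation_integrable:
  assumes "integrable M f"
  shows "ext_expectation M f = ereal (integral\<^sup>L M f)"
proof -
  obtain r q where "0 \<le> r" "0 \<le> q" "(\<integral>\<^sup>+x. ennreal (f x) \<partial>M) = ennreal r"
    "(\<integral>\<^sup>+x. ennreal (- f x) \<partial>M) = ennreal q" "integral\<^sup>L M f = r - q"
    using assms by (rule integrableE)
  then show ?thesis
    by (simp add: ext_expectation_def enn2ereal_ennreal)
qed

lemma ext_expectation_nonneg:
  assumes "\<And>\<omega>. 0 \<le> f \<omega>"
  shows "ext_expectation M f = enn2ereal (\<integral>\<^sup>+ \<omega>. ennreal (f \<omega>) \<partial>M)"
  using assms by (simp add: ext_expectation_def ennreal_neg zero_ennreal.rep_eq)

end

theory Submission
  imports Defs
begin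

text \<open>
  Write \<open>U\<^sub>k = Y\<^sub>k - X\<^sub>k\<close> and \<open>V\<^sub>k = Z\<^sub>k - X\<^sub>k\<close>.  The event \<open>T\<^sup>1 \<le> u, T\<^sup>2 \<le> v\<close> is the event that a
  killed Markov chain lives for ever: the chain starts at \<open>(u, v)\<close>, dies if \<open>u < U\<close>, and
  otherwise moves to \<open>(min (u - U) (v - V), v - V)\<close>.  Let \<open>K\<close> be its transition operator
  (\<open>killed_step\<close>).  Then the probability of surviving \<open>n\<close> steps is \<open>K\<^sup>n 1\<close>, it decreases to \<open>\<psi>\<close>,
  and \<open>K \<psi> = \<psi>\<close>.  The drift conditions say that \<open>\<gamma>\<close> is a subsolution and \<open>\<eta>\<close> a supersolution of
  this fixed point equation.

  Stability and light tails give some \<open>\<theta> > 0\<close> with \<open>E exp (\<theta> U) < 1\<close> and \<open>E exp (\<theta> V) < 1\<close>.  For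
  this \<open>\<theta>\<close>, a suitable combination \<open>h\<close> of \<open>exp (- \<theta> u)\<close> and \<open>exp (- \<theta> v)\<close> satisfies \<open>K h \<le> \<rho> h\<close> with
  \<open>\<rho> < 1\<close> (\<open>killed_step_lyap\<close>).  Hence the surviving chain escapes to \<open>(\<infinity>, \<infinity>)\<close> geometrically fast,
  where \<open>\<gamma>\<close> and \<open>\<eta>\<close> are close to \<open>1\<close>.  Iterating the drift inequalities \<open>n\<close> times, with \<open>\<gamma> \<le> a + C h\<close>
  for any \<open>a > 1\<close>, and \<open>a \<psi> \<le> \<eta> + C h\<close> for any \<open>a < 1\<close>, gives \<open>\<gamma> \<le> \<psi> \<le> \<eta>\<close>
  (\<open>lower_test_function\<close>, \<open>upper_test_function\<close>).

  For the queues, unfolding the departure recursions backwards in time shows that the waiting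
  and sojourn time of job \<open>n\<close> is at most \<open>x\<close> iff the chain driven by jobs \<open>n - 1, ..., 0\<close>
  survives all \<open>n\<close> steps, started from a state that depends only on \<open>Y\<^sub>n, Z\<^sub>n, Z\<^sub>n\<^sub>+\<^sub>1\<close>
  (\<open>sojourn_time_le_iff\<close>, \<open>waiting_time_le_iff\<close>).  That state is independent of the driving jobs,
  so the distribution functions are expectations of \<open>K\<^sup>n 1\<close>.  They decrease in \<open>n\<close>, and this
  monotonicity identifies the weak limit at every point, not only at continuity points.
\<close>

section \<open>Weak limits of decreasing distribution functions\<close>

text \<open>
  Distribution functions are nondecreasing and right-continuous, and a decreasing limit of such
  functions inherits both properties.  So the limit and the distribution function of the weak limit, which agree at
  continuity points, agree everywhere.
\<close>

lemma weak_limit_of_decreasing_cdfs: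
  assumes \<mu>: "\<And>n. real_distribution (\<mu> n)" "real_distribution \<nu>"
    and conv: "weak_conv_m \<mu> \<nu>"
    and dec: "\<And>x. decseq (\<lambda>n. cdf (\<mu> n) x)"
  shows "(\<lambda>n. cdf (\<mu> n) x) \<longlonglongrightarrow> cdf \<nu> x"
proof -
  interpret \<nu>: real_distribution \<nu> by fact
  interpret \<mu>: real_distribution "\<mu> n" for n by (rule \<mu>(1))
  have cont: "(\<lambda>n. cdf (\<mu> n) y) \<longlonglongrightarrow> cdf \<nu> y" if "isCont (cdf \<nu>) y" for y
    using conv that by (simp add: weak_conv_m_def weak_conv_def)
  define L where "L = (INF n. cdf (\<mu> n) x)"
  have bdd: "bdd_below (range (\<lambda>n. cdf (\<mu> n) y))" for y
    by (intro bdd_belowI[where m=0]) (auto simp: \<mu>.cdf_nonneg)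
  have L: "(\<lambda>n. cdf (\<mu> n) x) \<longlonglongrightarrow> L"
    unfolding L_def by (rule LIMSEQ_decseq_INF[OF bdd dec])
  have ex: "\<exists>y. x < y \<and> y < z \<and> isCont (cdf \<nu>) y" if "x < z" for z
    using open_minus_countable[OF \<nu>.countable_support, of "{x<..<z}"] that
    by (auto simp: \<nu>.isCont_cdf)
  have up: "((\<lambda>y. c - cdf N y) \<longlongrightarrow> c - cdf N x) (at_right x)" if "real_distribution N" for N c
    using finite_borel_measure.cdf_is_right_cont[OF real_distribution.finite_borel_measure_M[OF that], of x]
    unfolding continuous_within by (intro tendsto_intros)
  have "L \<le> cdf \<nu> x"
  proof (rule ccontr)
    assume "\<not> ?thesis"
    then have "0 < L - cdf \<nu> x" by simp
    with up[OF \<mu>(2)] have "eventually (\<lambda>y. 0 < L - cdf \<nu> y) (at_right x)"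
      by (rule order_tendstoD)
    then obtain z where z: "x < z" "\<And>y. x < y \<Longrightarrow> y < z \<Longrightarrow> cdf \<nu> y < L"
      unfolding eventually_at_right_field by auto
    with ex obtain y where y: "x < y" "y < z" "isCont (cdf \<nu>) y" by blast
    have "L \<le> cdf \<nu> y"
      using L cont[OF y(3)] by (rule LIMSEQ_le) (use y in \<open>auto intro!: \<mu>.cdf_nondecreasing\<close>)
    with z(2)[OF y(1,2)] show False by simp
  qed
  moreover have "cdf \<nu> x \<le> cdf (\<mu> n) x" for n
  proof (rule ccontr)
    assume "\<not> ?thesis"
    then have "0 < cdf \<nu> x - cdf (\<mu> n) x" by simp
    with up[OF \<mu>(1)] have "eventually (\<lambda>y. 0 < cdf \<nu> x - cdf (\<mu> n) y) (at_right x)"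
      by (rule order_tendstoD)
    then obtain z where z: "x < z" "\<And>y. x < y \<Longrightarrow> y < z \<Longrightarrow> cdf (\<mu> n) y < cdf \<nu> x"
      unfolding eventually_at_right_field by auto
    with ex obtain y where y: "x < y" "y < z" "isCont (cdf \<nu>) y" by blast
    have "cdf \<nu> x \<le> cdf \<nu> y" using y by (intro \<nu>.cdf_nondecreasing) simp
    also have "\<dots> \<le> cdf (\<mu> n) y"
      by (rule decseq_ge[OF dec cont[OF y(3)]])
    finally show False using z(2)[OF y(1,2)] by simp
  qed
  then have "cdf \<nu> x \<le> L" unfolding L_def by (intro cINF_greatest) auto
  ultimately show ?thesis using L by simp
qed

section \<open>The killed chain and its survival probabilities\<close>

locale killed_walk = prob_space M for M :: "'a measure" +
  fixes U V :: "'a \<Rightarrow> real"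
  assumes measurable_U [measurable]: "U \<in> borel_measurable M"
    and measurable_V [measurable]: "V \<in> borel_measurable M"
begin

definition killed_step :: "(real \<times> real \<Rightarrow> ennreal) \<Rightarrow> real \<times> real \<Rightarrow> ennreal" where
  "killed_step f p = (\<integral>\<^sup>+ \<omega>. indicator {..fst p} (U \<omega>) *
     f (min (fst p - U \<omega>) (snd p - V \<omega>), snd p - V \<omega>) \<partial>M)"

lemma measurable_killed_step [measurable]:
  assumes [measurable]: "f \<in> borel_measurable borel"
  shows "killed_step f \<in> borel_measurable borel"
proof -
  have [measurable]: "f \<in> borel_measurable (borel \<Otimes>\<^sub>M borel)" using assms by (simp add: borel_prod)
  have "(\<lambda>p. \<integral>\<^sup>+ \<omega>. (if U \<omega> \<le> fst p then 1 else 0) *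
     f (min (fst p - U \<omega>) (snd p - V \<omega>), snd p - V \<omega>) \<partial>M) \<in> borel_measurable (borel \<Otimes>\<^sub>M borel)"
    by (rule borel_measurable_nn_integral) measurable
  then show ?thesis
    unfolding killed_step_def[abs_def] by (simp add: borel_prod indicator_def of_bool_def)
qed

lemma measurable_killed_step_pow [measurable]:
  "f \<in> borel_measurable borel \<Longrightarrow> (killed_step ^^ n) f \<in> borel_measurable borel"
  by (induction n) auto

lemma killed_step_mono: "(\<And>p. f p \<le> g p) \<Longrightarrow> killed_step f p \<le> killed_step g p"
  unfolding killed_step_def by (intro nn_integral_mono mult_left_mono) auto

lemma killed_step_pow_mono: "(\<And>p. f p \<le> g p) \<Longrightarrow> (killed_step ^^ n) f p \<le> (killed_step ^^ n) g p"
  by (induction n arbitrary: p) (auto intro: killed_step_mono)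

lemma measurable_next_state [measurable]:
  assumes [measurable]: "f \<in> borel_measurable borel"
  shows "(\<lambda>\<omega>. f (min (u - U \<omega>) (v - V \<omega>), v - V \<omega>)) \<in> borel_measurable M"
proof -
  have [measurable]: "f \<in> borel_measurable (borel \<Otimes>\<^sub>M borel)" using assms by (simp add: borel_prod)
  show ?thesis by measurable
qed

lemma killed_step_add_cmult:
  assumes [measurable]: "f \<in> borel_measurable borel" "g \<in> borel_measurable borel"
  shows "killed_step (\<lambda>p. a * f p + b * g p) p = a * killed_step f p + b * killed_step g p"
proof -
  have "killed_step (\<lambda>p. a * f p + b * g p) p =
    (\<integral>\<^sup>+ \<omega>. a * (indicator {..fst p} (U \<omega>) * f (min (fst p - U \<omega>) (snd p - V \<omega>), snd p - V \<omega>)) +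
     b * (indicator {..fst p} (U \<omega>) * g (min (fst p - U \<omega>) (snd p - V \<omega>), snd p - V \<omega>)) \<partial>M)"
    unfolding killed_step_def by (intro nn_integral_cong) (simp add: algebra_simps)
  also have "\<dots> = a * killed_step f p + b * killed_step g p"
    unfolding killed_step_def by (simp add: nn_integral_add nn_integral_cmult)
  finally show ?thesis .
qed

lemma killed_step_pow_add_cmult:
  assumes [measurable]: "f \<in> borel_measurable borel" "g \<in> borel_measurable borel"
  shows "(killed_step ^^ n) (\<lambda>p. a * f p + b * g p) p = a * (killed_step ^^ n) f p + b * (killed_step ^^ n) g p"
proof (induction n arbitrary: p)
  case (Suc n)
  then have "(killed_step ^^ n) (\<lambda>p. a * f p + b * g p) =
    (\<lambda>p. a * (killed_step ^^ n) f p + b * (killed_step ^^ n) g p)" by (simp add: fun_eq_iff)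
  then show ?case by (simp add: killed_step_add_cmult)
qed simp

definition survival :: "nat \<Rightarrow> real \<times> real \<Rightarrow> ennreal" where
  "survival n = (killed_step ^^ n) (\<lambda>_. 1)"

definition eternal_survival :: "real \<times> real \<Rightarrow> ennreal" where
  "eternal_survival p = (INF n. survival n p)"

lemma survival_0 [simp]: "survival 0 p = 1"
  by (simp add: survival_def)

lemma survival_Suc: "survival (Suc n) = killed_step (survival n)"
  by (simp add: survival_def)

lemma measurable_survival [measurable]: "survival n \<in> borel_measurable borel"
  unfolding survival_def by measurable

lemma measurable_eternal_survival [measurable]: "eternal_survival \<in> borel_measurable borel"
  unfolding eternal_survival_def[abs_def] by measurable

lemma killed_step_le_1: "(\<And>p. f p \<le> 1) \<Longrightarrow> killed_step f p \<le> 1"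
  unfolding killed_step_def
  by (rule order_trans[OF nn_integral_mono[where v="\<lambda>_. 1"]])
     (auto simp: emeasure_space_1 indicator_def)

lemma survival_Suc_le: "survival (Suc n) p \<le> survival n p"
proof (induction n arbitrary: p)
  case 0 then show ?case by (simp add: survival_Suc killed_step_le_1)
next
  case (Suc n) then show ?case by (subst (1 2) survival_Suc) (rule killed_step_mono)
qed

lemma decseq_survival: "decseq (\<lambda>n. survival n p)"
  by (intro decseq_SucI survival_Suc_le)

lemma survival_le_1: "survival n p \<le> 1"
  using decseqD[OF decseq_survival, of 0 n p] by simp

lemma eternal_survival_le_1: "eternal_survival p \<le> 1"
  unfolding eternal_survival_def by (rule INF_lower2[of 0]) auto

lemma survival_tendsto: "(\<lambda>n. survival n p) \<longlonglongrightarrow> eternal_survival p"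
  unfolding eternal_survival_def by (rule LIMSEQ_INF[OF decseq_survival])

text \<open>
  Dominated convergence in the recursion for the probabilities of surviving \<open>n\<close> steps.
\<close>

lemma killed_step_eternal_survival: "killed_step eternal_survival = eternal_survival"
proof
  fix p
  let ?next = "\<lambda>\<omega>. (min (fst p - U \<omega>) (snd p - V \<omega>), snd p - V \<omega>)"
  have "(\<lambda>n. killed_step (survival n) p) \<longlonglongrightarrow> killed_step eternal_survival p"
    unfolding killed_step_def
  proof (rule nn_integral_dominated_convergence[where w="\<lambda>_. 1"])
    show "AE \<omega> in M. (\<lambda>n. indicator {..fst p} (U \<omega>) * survival n (?next \<omega>))
      \<longlonglongrightarrow> indicator {..fst p} (U \<omega>) * eternal_survival (?next \<omega>)"
      by (intro AE_I2 ennreal_tendsto_cmult survival_tendsto) (auto simp: indicator_def)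
    show "AE \<omega> in M. indicator {..fst p} (U \<omega>) * survival n (?next \<omega>) \<le> 1" for n
      by (intro AE_I2) (auto simp: indicator_def survival_le_1)
  qed (auto simp: emeasure_space_1)
  moreover have "(\<lambda>n. killed_step (survival n) p) \<longlonglongrightarrow> eternal_survival p"
    using LIMSEQ_Suc[OF survival_tendsto[of p]] by (simp add: survival_Suc)
  ultimately show "killed_step eternal_survival p = eternal_survival p"
    by (rule LIMSEQ_unique)
qed

lemma killed_step_pow_eternal_survival: "(killed_step ^^ n) eternal_survival = eternal_survival"
  by (induction n) (auto simp: killed_step_eternal_survival)

end

text \<open>
  The exponential moments below \<open>1\<close> replace the negative drifts \<open>E U < 0\<close> and \<open>E V < 0\<close>: they make
  escape to infinity quantitative, as in a Chernoff bound.
\<close>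

locale drifting_killed_walk = killed_walk +
  fixes \<theta> r :: real
  assumes \<theta>: "0 < \<theta>" and r: "0 \<le> r" "r < 1"
    and exp_U: "(\<integral>\<^sup>+ \<omega>. ennreal (exp (\<theta> * U \<omega>)) \<partial>M) \<le> ennreal r"
    and exp_V: "(\<integral>\<^sup>+ \<omega>. ennreal (exp (\<theta> * V \<omega>)) \<partial>M) \<le> ennreal r"
begin

text \<open>
  The second term dominates the contribution that the minimum in the transition passes from
  the second coordinate to the first.  The weight \<open>B = 2 / (1 - r)\<close> is chosen such that
  \<open>r (1 + 1 / B) < 1\<close>; this number is the contraction rate below.
\<close>

definition lyap :: "real \<times> real \<Rightarrow> ennreal" where
  "lyap p = ennreal (exp (- \<theta> * fst p)) + ennreal (2 / (1 - r)) * ennreal (exp (- \<theta> * snd p))"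

definition rate :: real where "rate = r * (1 + (1 - r) / 2)"

lemma rate: "0 \<le> rate" "rate < 1"
proof -
  have "r * (1 - r) \<le> 1 * (1 - r)" using r by (intro mult_right_mono) auto
  then have "r * (2 + (1 - r)) < 2" using r by (simp add: algebra_simps)
  then show "rate < 1" by (simp add: rate_def field_simps)
qed (use r in \<open>auto simp: rate_def\<close>)

lemma measurable_lyap [measurable]: "lyap \<in> borel_measurable borel"
  unfolding lyap_def[abs_def] by (simp add: borel_prod[symmetric])

text \<open>
  Since \<open>exp (- \<theta> min s t) \<le> exp (- \<theta> s) + exp (- \<theta> t)\<close>, one step costs the factor \<open>r\<close> and adds one
  more copy of \<open>r exp (- \<theta> v)\<close>, which is small relative to the weight of the second term.
\<close>

lemma killed_step_lyap: "killed_step lyap p \<le> ennreal rate * lyap p"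
proof -
  obtain u v where p: "p = (u, v)" by (cases p)
  define B where "B = 2 / (1 - r)"
  have B: "0 < B" using r by (simp add: B_def)
  have "killed_step lyap p \<le> (\<integral>\<^sup>+ \<omega>. ennreal (exp (- \<theta> * u)) * ennreal (exp (\<theta> * U \<omega>)) +
     ennreal ((1 + B) * exp (- \<theta> * v)) * ennreal (exp (\<theta> * V \<omega>)) \<partial>M)"
    unfolding killed_step_def
  proof (rule nn_integral_mono)
    fix \<omega>
    let ?u = "u - U \<omega>" and ?v = "v - V \<omega>"
    have "exp (- \<theta> * min ?u ?v) \<le> exp (- \<theta> * ?u) + exp (- \<theta> * ?v)"
      by (auto simp: min_def)
    then have "exp (- \<theta> * min ?u ?v) + B * exp (- \<theta> * ?v) \<le>
      exp (- \<theta> * u) * exp (\<theta> * U \<omega>) + (1 + B) * exp (- \<theta> * v) * exp (\<theta> * V \<omega>)"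
      by (simp add: algebra_simps flip: exp_add)
    then have "lyap (min ?u ?v, ?v) \<le> ennreal (exp (- \<theta> * u)) * ennreal (exp (\<theta> * U \<omega>)) +
       ennreal ((1 + B) * exp (- \<theta> * v)) * ennreal (exp (\<theta> * V \<omega>))"
      using B unfolding lyap_def B_def[symmetric]
      by (simp add: ennreal_plus[symmetric] ennreal_mult[symmetric] ennreal_leI del: ennreal_plus)
    then show "indicator {..fst p} (U \<omega>) * lyap (min (fst p - U \<omega>) (snd p - V \<omega>), snd p - V \<omega>) \<le>
       ennreal (exp (- \<theta> * u)) * ennreal (exp (\<theta> * U \<omega>)) +
       ennreal ((1 + B) * exp (- \<theta> * v)) * ennreal (exp (\<theta> * V \<omega>))"
      by (auto simp: p indicator_def)
  qed
  also have "\<dots> = ennreal (exp (- \<theta> * u)) * (\<integral>\<^sup>+ \<omega>. ennreal (exp (\<theta> * U \<omega>)) \<partial>M) +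
      ennreal ((1 + B) * exp (- \<theta> * v)) * (\<integral>\<^sup>+ \<omega>. ennreal (exp (\<theta> * V \<omega>)) \<partial>M)"
    by (simp add: nn_integral_add nn_integral_cmult)
  also have "\<dots> \<le> ennreal (exp (- \<theta> * u)) * ennreal r + ennreal ((1 + B) * exp (- \<theta> * v)) * ennreal r"
    by (intro add_mono mult_left_mono exp_U exp_V) auto
  also have "\<dots> = ennreal (exp (- \<theta> * u) * r + (1 + B) * exp (- \<theta> * v) * r)"
    using r B by (simp add: ennreal_plus[symmetric] ennreal_mult[symmetric] del: ennreal_plus)
  also have "\<dots> \<le> ennreal (rate * (exp (- \<theta> * u) + B * exp (- \<theta> * v)))"
  proof (rule ennreal_leI)
    have 1: "(1 + B) * r = rate * B" unfolding rate_def B_def using r by (simp add: field_simps)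
    have 2: "exp (- \<theta> * u) * r \<le> exp (- \<theta> * u) * rate" using r
      by (intro mult_left_mono) (auto simp: rate_def algebra_simps mult_left_le)
    have "(1 + B) * exp (- \<theta> * v) * r = rate * (B * exp (- \<theta> * v))"
      using arg_cong[OF 1, of "\<lambda>t. t * exp (- \<theta> * v)"] by (simp add: ac_simps)
    with 2 show "exp (- \<theta> * u) * r + (1 + B) * exp (- \<theta> * v) * r \<le> rate * (exp (- \<theta> * u) + B * exp (- \<theta> * v))"
      by (simp add: algebra_simps)
  qed
  also have "\<dots> = ennreal rate * lyap p"
    using rate B unfolding lyap_def p B_def[symmetric]
    by (simp add: ennreal_plus[symmetric] ennreal_mult[symmetric] del: ennreal_plus)
  finally show ?thesis .
qed

lemma killed_step_pow_lyap: "(killed_step ^^ n) lyap p \<le> ennreal (rate ^ n) * lyap p"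
proof (induction n arbitrary: p)
  case (Suc n)
  have "(killed_step ^^ Suc n) lyap p \<le> killed_step (\<lambda>p. ennreal (rate ^ n) * lyap p + 0 * 0) p"
    by (auto intro!: killed_step_mono Suc)
  also have "\<dots> = ennreal (rate ^ n) * killed_step lyap p"
    by (subst killed_step_add_cmult) auto
  also have "\<dots> \<le> ennreal (rate ^ n) * (ennreal rate * lyap p)"
    by (intro mult_left_mono killed_step_lyap) auto
  also have "\<dots> = ennreal (rate ^ Suc n) * lyap p"
    using rate by (simp add: ennreal_mult ac_simps)
  finally show ?case .
qed simp

lemma killed_step_pow_lyap_tendsto:
  assumes "C < \<top>"
  shows "(\<lambda>n. C * (killed_step ^^ n) lyap p) \<longlonglongrightarrow> 0"
proof -
  have fin: "lyap p < \<top>" unfolding lyap_def by (simp add: ennreal_mult_less_top)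
  have "(\<lambda>n. rate ^ n) \<longlonglongrightarrow> 0" using rate by (intro LIMSEQ_power_zero) auto
  then have "(\<lambda>n. ennreal (rate ^ n)) \<longlonglongrightarrow> ennreal 0"
    by (intro tendsto_ennrealI)
  then have "(\<lambda>n. (C * lyap p) * ennreal (rate ^ n)) \<longlonglongrightarrow> (C * lyap p) * ennreal 0"
    using assms fin by (intro ennreal_tendsto_cmult) (auto simp: ennreal_mult_less_top)
  then have "(\<lambda>n. C * (ennreal (rate ^ n) * lyap p)) \<longlonglongrightarrow> 0" by (simp add: ac_simps)
  then show ?thesis
    by (rule tendsto_sandwich[OF _ _ tendsto_const, rotated 2])
       (auto intro!: always_eventually mult_left_mono killed_step_pow_lyap)
qed

text \<open>
  States with a small coordinate carry a large value of the Lyapunov function.  Bounds that hold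
  far out thus extend to all states up to a multiple of that function.
\<close>

lemma one_le_lyap:
  assumes "u < c \<or> v < c"
  shows "1 \<le> ennreal (exp (\<theta> * c)) * lyap (u, v)"
proof -
  have "1 \<le> 2 / (1 - r)" using r by simp
  then have "exp (- \<theta> * v) \<le> 2 / (1 - r) * exp (- \<theta> * v)"
    by (metis exp_ge_zero mult_le_cancel_right1 mult_right_mono mult_1)
  moreover have "exp (- \<theta> * c) \<le> exp (- \<theta> * u) + exp (- \<theta> * v)"
  proof -
    have "exp (- \<theta> * c) \<le> exp (- \<theta> * u) \<or> exp (- \<theta> * c) \<le> exp (- \<theta> * v)" using assms \<theta> by auto
    then show ?thesis by (smt (verit) exp_ge_zero)
  qed
  ultimately have "exp (- \<theta> * c) \<le> exp (- \<theta> * u) + 2 / (1 - r) * exp (- \<theta> * v)" by linarith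
  then have "exp (\<theta> * c) * exp (- \<theta> * c) \<le> exp (\<theta> * c) * (exp (- \<theta> * u) + 2 / (1 - r) * exp (- \<theta> * v))"
    by (intro mult_left_mono) auto
  then have "1 \<le> exp (\<theta> * c) * (exp (- \<theta> * u) + 2 / (1 - r) * exp (- \<theta> * v))"
    by (simp flip: exp_add)
  then have "ennreal 1 \<le> ennreal (exp (\<theta> * c) * (exp (- \<theta> * u) + 2 / (1 - r) * exp (- \<theta> * v)))"
    by (rule ennreal_leI)
  then show ?thesis using r
    by (simp add: lyap_def ennreal_plus[symmetric] ennreal_mult[symmetric] del: ennreal_plus)
qed

text \<open>
  After \<open>n\<close> steps the constant \<open>a\<close> becomes \<open>a\<close> times the \<open>n\<close>-step survival probability, and the error
  term decays geometrically.
\<close>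

lemma subsolution_le_eternal_survival:
  assumes [measurable]: "f \<in> borel_measurable borel"
    and sub: "\<And>p. f p \<le> killed_step f p"
    and C: "C < \<top>" and a: "a < \<top>" and le: "\<And>p. f p \<le> a + C * lyap p"
  shows "f p \<le> a * eternal_survival p"
proof -
  have iter: "f p \<le> (killed_step ^^ n) f p" for n p
  proof (induction n arbitrary: p)
    case (Suc n)
    have "f p \<le> killed_step f p" by (rule sub)
    also have "\<dots> \<le> (killed_step ^^ Suc n) f p" by (simp add: killed_step_mono Suc)
    finally show ?case .
  qed simp
  have "f p \<le> a * survival n p + C * (killed_step ^^ n) lyap p" for n
  proof -
    have "f p \<le> (killed_step ^^ n) (\<lambda>p. a * 1 + C * lyap p) p"
      by (rule order_trans[OF iter killed_step_pow_mono]) (use le in auto)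
    also have "\<dots> = a * survival n p + C * (killed_step ^^ n) lyap p"
      unfolding survival_def by (rule killed_step_pow_add_cmult) auto
    finally show ?thesis .
  qed
  moreover have "(\<lambda>n. a * survival n p + C * (killed_step ^^ n) lyap p) \<longlonglongrightarrow> a * eternal_survival p + 0"
    using a C by (intro tendsto_add ennreal_tendsto_cmult survival_tendsto killed_step_pow_lyap_tendsto)
  ultimately show ?thesis by (auto intro!: LIMSEQ_le_const)
qed

text \<open>
  The function \<open>eternal_survival\<close> is a fixed point, so iterating the comparison affects only
  the right-hand side: \<open>f\<close> does not grow and the error term disappears.
\<close>

lemma eternal_survival_le_supersolution:
  assumes [measurable]: "f \<in> borel_measurable borel"
    and super: "\<And>p. killed_step f p \<le> f p"
    and C: "C < \<top>" and le: "\<And>p. a * eternal_survival p \<le> f p + C * lyap p"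
  shows "a * eternal_survival p \<le> f p"
proof -
  have iter: "(killed_step ^^ n) f p \<le> f p" for n p
  proof (induction n arbitrary: p)
    case (Suc n)
    have "(killed_step ^^ Suc n) f p \<le> killed_step f p" by (simp add: killed_step_mono Suc)
    also have "\<dots> \<le> f p" by (rule super)
    finally show ?case .
  qed simp
  have "a * eternal_survival p \<le> f p + C * (killed_step ^^ n) lyap p" for n
  proof -
    have "a * eternal_survival p = (killed_step ^^ n) (\<lambda>p. a * eternal_survival p + 0 * 0) p"
      by (subst killed_step_pow_add_cmult) (auto simp: killed_step_pow_eternal_survival)
    also have "\<dots> \<le> (killed_step ^^ n) (\<lambda>p. 1 * f p + C * lyap p) p"
      by (rule killed_step_pow_mono) (use le in auto)
    also have "\<dots> = 1 * (killed_step ^^ n) f p + C * (killed_step ^^ n) lyap p"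
      by (rule killed_step_pow_add_cmult) auto
    also have "\<dots> \<le> f p + C * (killed_step ^^ n) lyap p"
      using iter by (auto intro: add_right_mono)
    finally show ?thesis .
  qed
  moreover have "(\<lambda>n. f p + C * (killed_step ^^ n) lyap p) \<longlonglongrightarrow> f p + 0"
    using C by (intro tendsto_add killed_step_pow_lyap_tendsto) auto
  ultimately show ?thesis by (auto intro!: LIMSEQ_le_const)
qed

end

section \<open>Test functions below and above the survival probability\<close>

text \<open>
  Every neighbourhood of \<open>(\<infinity>, \<infinity>)\<close> contains the quadrant of all pairs above some real level.
\<close>

lemma Limsup_at_infinity_bound:
  fixes f :: "ereal \<times> ereal \<Rightarrow> real"
  assumes "Limsup (at (\<infinity>, \<infinity>)) (\<lambda>p. ereal (f p)) < ereal a"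
  obtains c :: real where "\<And>u v. c \<le> u \<Longrightarrow> c \<le> v \<Longrightarrow> f (ereal u, ereal v) < a"
proof -
  have "eventually (\<lambda>p. ereal (f p) < ereal a) (at (\<infinity>, \<infinity>))"
    by (rule Limsup_lessD[OF assms])
  then have "eventually (\<lambda>p. p \<noteq> (\<infinity>, \<infinity>) \<longrightarrow> f p < a) (nhds (\<infinity>, \<infinity>))"
    by (simp add: eventually_at_filter)
  then obtain P Q where PQ: "eventually P (nhds \<infinity>)" "eventually Q (nhds \<infinity>)"
    "\<And>u v. P u \<Longrightarrow> Q v \<Longrightarrow> (u, v) \<noteq> (\<infinity>, \<infinity>) \<longrightarrow> f (u, v) < a"
    unfolding nhds_prod eventually_prod_filter by blast
  have "eventually (\<lambda>u. P u \<and> Q u) (nhds \<infinity>)" using PQ(1,2) by eventually_elim simp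
  then obtain c where c: "\<And>u. ereal c < u \<Longrightarrow> P u \<and> Q u"
    unfolding eventually_nhds
    by (metis open_PInfty2 greaterThan_iff  subsetD open_PInfty)
  show ?thesis
    by (rule that[of "c + 1"]) (use PQ(3) c in \<open>auto\<close>)
qed

lemma Liminf_at_infinity_bound:
  fixes f :: "ereal \<times> ereal \<Rightarrow> real"
  assumes "ereal a < Liminf (at (\<infinity>, \<infinity>)) (\<lambda>p. ereal (f p))"
  obtains c :: real where "\<And>u v. c \<le> u \<Longrightarrow> c \<le> v \<Longrightarrow> a < f (ereal u, ereal v)"
proof -
  have "Limsup (at (\<infinity>, \<infinity>)) (\<lambda>p. ereal (- f p)) = - Liminf (at (\<infinity>, \<infinity>)) (\<lambda>p. ereal (f p))"
    using ereal_Limsup_uminus[of "at (\<infinity>, \<infinity>)" "\<lambda>p. ereal (f p)"] by simp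
  then have "Limsup (at (\<infinity>, \<infinity>)) (\<lambda>p. ereal (- f p)) < ereal (- a)"
    using assms by (simp add: ereal_uminus_less_reorder)
  then obtain c where "\<And>u v. c \<le> u \<Longrightarrow> c \<le> v \<Longrightarrow> - f (ereal u, ereal v) < - a"
    by (rule Limsup_at_infinity_bound) blast
  then show ?thesis by (intro that[of c]) auto
qed

lemma ennreal_le_of_all_factors_gt_1:
  fixes x y :: ennreal
  assumes "\<And>a. 1 < a \<Longrightarrow> x \<le> ennreal a * y"
  shows "x \<le> y"
proof -
  have "(\<lambda>n. ennreal (1 + 1 / Suc n)) \<longlonglongrightarrow> ennreal (1 + 0)"
    by (intro tendsto_ennrealI tendsto_intros LIMSEQ_Suc[OF lim_const_over_n])
  then have "(\<lambda>n. y * ennreal (1 + 1 / Suc n)) \<longlonglongrightarrow> y * ennreal (1 + 0)"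
    by (intro tendsto_mult_ennreal tendsto_const) auto
  then have "(\<lambda>n. ennreal (1 + 1 / Suc n) * y) \<longlonglongrightarrow> y" by (simp add: ac_simps)
  then show ?thesis
    by (rule LIMSEQ_le_const) (intro exI allI impI assms, simp)
qed

lemma ennreal_le_of_all_factors_lt_1:
  fixes x y :: ennreal
  assumes "\<And>a. 0 < a \<Longrightarrow> a < 1 \<Longrightarrow> ennreal a * x \<le> y"
  shows "x \<le> y"
proof -
  have *: "1 - 1 / real (Suc (Suc n)) = real (Suc n) / real (Suc (Suc n))" for n
    by (simp add: field_simps)
  have "(\<lambda>n. ennreal (1 - 1 / Suc (Suc n))) \<longlonglongrightarrow> ennreal (1 - 0)"
    by (intro tendsto_ennrealI tendsto_intros LIMSEQ_Suc[OF LIMSEQ_Suc[OF lim_const_over_n]])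
  then have "(\<lambda>n. x * ennreal (1 - 1 / Suc (Suc n))) \<longlonglongrightarrow> x * ennreal (1 - 0)"
    by (intro tendsto_mult_ennreal tendsto_const) auto
  then have "(\<lambda>n. ennreal (1 - 1 / Suc (Suc n)) * x) \<longlonglongrightarrow> x" by (simp add: ac_simps)
  then show ?thesis
    by (rule LIMSEQ_le_const2) (use assms[of "1 - 1 / Suc (Suc n)" for n] in \<open>auto simp del: of_nat_Suc\<close>)
qed

lemma ext_expectation_le:
  "ext_expectation M f \<le> enn2ereal (\<integral>\<^sup>+ \<omega>. ennreal (f \<omega>) \<partial>M)"
  unfolding ext_expectation_def
  by (metis ereal_diff_le_self enn2ereal_nonneg)

context drifting_killed_walk
begin

lemma measurable_on_reals [measurable]:
  assumes "\<phi> \<in> borel_measurable borel"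
  shows "(\<lambda>p. \<phi> (ereal (fst p), ereal (snd p))) \<in> borel_measurable (borel :: (real \<times> real) measure)"
  by (rule measurable_compose[OF _ assms]) (simp add: borel_prod[symmetric])

lemma nn_integral_next_state:
  "(\<integral>\<^sup>+ \<omega>. ennreal (of_bool (ereal (U \<omega>) \<le> ereal u) *
      \<phi> (min (ereal u - ereal (U \<omega>)) (ereal v - ereal (V \<omega>)), ereal v - ereal (V \<omega>))) \<partial>M) =
    killed_step (\<lambda>p. ennreal (\<phi> (ereal (fst p), ereal (snd p)))) (u, v)"
  unfolding killed_step_def by (intro nn_integral_cong) (auto simp: indicator_def min_def)

lemma ext_expectation_next_state:
  assumes "\<And>p. 0 \<le> \<phi> p"
  shows "ext_expectation M (\<lambda>\<omega>. of_bool (ereal (U \<omega>) \<le> ereal u) *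
      \<phi> (min (ereal u - ereal (U \<omega>)) (ereal v - ereal (V \<omega>)), ereal v - ereal (V \<omega>))) =
    enn2ereal (killed_step (\<lambda>p. ennreal (\<phi> (ereal (fst p), ereal (snd p)))) (u, v))"
  by (subst ext_expectation_nonneg) (simp add: assms, simp only: nn_integral_next_state)

text \<open>
  The positive part of \<open>\<gamma>\<close> is a subsolution at every real state: where \<open>\<gamma>\<close> is not positive there is
  nothing to show.  Far out it is below any \<open>a > 1\<close>, elsewhere it is bounded by a multiple of the
  Lyapunov function.
\<close>

lemma lower_test_function:
  fixes \<gamma> :: "ereal \<times> ereal \<Rightarrow> real"
  assumes [measurable]: "\<gamma> \<in> borel_measurable borel"
    and bounded: "\<And>p. \<gamma> p \<le> K"
    and limsup: "Limsup (at (\<infinity>, \<infinity>)) (\<lambda>p. ereal (\<gamma> p)) \<le> 1"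
    and drift: "\<And>u v :: real. 0 < \<gamma> (ereal u, ereal v) \<Longrightarrow> ereal (\<gamma> (ereal u, ereal v)) \<le>
      ext_expectation M (\<lambda>\<omega>. of_bool (ereal u \<ge> ereal (U \<omega>)) *
        \<gamma> (min (ereal u - ereal (U \<omega>)) (ereal v - ereal (V \<omega>)), ereal v - ereal (V \<omega>)))"
  shows "ennreal (\<gamma> (ereal u, ereal v)) \<le> eternal_survival (u, v)"
proof (rule ennreal_le_of_all_factors_gt_1)
  fix a :: real assume a: "1 < a"
  define f where "f = (\<lambda>p. ennreal (\<gamma> (ereal (fst p), ereal (snd p))))"
  have f[measurable]: "f \<in> borel_measurable borel" unfolding f_def by measurable
  have "Limsup (at (\<infinity>, \<infinity>)) (\<lambda>p. ereal (\<gamma> p)) < ereal a"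
    using limsup a by (simp add: le_less_trans one_ereal_def)
  then obtain c where c: "\<And>u v. c \<le> u \<Longrightarrow> c \<le> v \<Longrightarrow> \<gamma> (ereal u, ereal v) < a"
    by (rule Limsup_at_infinity_bound) blast
  define C where "C = ennreal (max K 0 * exp (\<theta> * c))"
  have "f (u, v) \<le> ennreal a * eternal_survival (u, v)"
  proof (rule subsolution_le_eternal_survival[OF f])
    show "f p \<le> killed_step f p" for p
    proof (cases "0 < \<gamma> (ereal (fst p), ereal (snd p))")
      case True
      from order_trans[OF drift[OF True] ext_expectation_le]
      have "ereal (\<gamma> (ereal (fst p), ereal (snd p))) \<le> enn2ereal (killed_step f p)"
        unfolding nn_integral_next_state f_def by simp
      then show ?thesis using True
        by (simp add: f_def less_eq_ennreal.rep_eq)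
    qed (simp add: f_def ennreal_neg)
    show "f p \<le> ennreal a + C * lyap p" for p
    proof (cases "c \<le> fst p \<and> c \<le> snd p")
      case True
      then have "f p \<le> ennreal a" unfolding f_def
        by (intro ennreal_leI less_imp_le[OF c]) auto
      then show ?thesis by (rule order_trans) simp
    next
      case False
      then have 1: "1 \<le> ennreal (exp (\<theta> * c)) * lyap p"
        using one_le_lyap[of "fst p" c "snd p"] by auto
      have "f p \<le> ennreal (max K 0) * 1"
        unfolding f_def by (auto intro!: ennreal_leI simp: bounded le_max_iff_disj)
      also have "\<dots> \<le> ennreal (max K 0) * (ennreal (exp (\<theta> * c)) * lyap p)"
        by (intro mult_left_mono 1) auto
      also have "\<dots> = C * lyap p" unfolding C_def by (simp add: ennreal_mult ac_simps)
      finally show ?thesis by (rule order_trans) simp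
    qed
  qed (auto simp: C_def)
  then show "ennreal (\<gamma> (ereal u, ereal v)) \<le> ennreal a * eternal_survival (u, v)" by (simp add: f_def)
qed

text \<open>
  The inequality for \<open>\<eta>\<close> is available only on states with \<open>u \<le> v\<close> and positive survival
  probability.  Setting \<open>\<eta>\<close> to \<open>0\<close> where survival is impossible keeps it a supersolution, since such
  states lead only to states of the same kind; setting it to \<open>\<top>\<close> where \<open>v < u\<close> does so as well, since
  every transition ends in a state with \<open>u \<le> v\<close>.
\<close>

lemma upper_test_function:
  fixes \<eta> :: "ereal \<times> ereal \<Rightarrow> real"
  assumes [measurable]: "\<eta> \<in> borel_measurable borel"
    and nonneg: "\<And>p. 0 \<le> \<eta> p"
    and liminf: "1 \<le> Liminf (at (\<infinity>, \<infinity>)) (\<lambda>p. ereal (\<eta> p))"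
    and drift: "\<And>u v :: real. eternal_survival (u, v) \<noteq> 0 \<Longrightarrow> u \<le> v \<Longrightarrow>
      ext_expectation M (\<lambda>\<omega>. of_bool (ereal u \<ge> ereal (U \<omega>)) *
        \<eta> (min (ereal u - ereal (U \<omega>)) (ereal v - ereal (V \<omega>)), ereal v - ereal (V \<omega>)))
      \<le> ereal (\<eta> (ereal u, ereal v))"
    and "u \<le> v"
  shows "eternal_survival (u, v) \<le> ennreal (\<eta> (ereal u, ereal v))"
proof (rule ennreal_le_of_all_factors_lt_1)
  fix a :: real assume a: "0 < a" "a < 1"
  define e where "e = (\<lambda>p. ennreal (\<eta> (ereal (fst p), ereal (snd p))))"
  have [measurable]: "e \<in> borel_measurable borel" unfolding e_def by measurable
  \<comment> \<open>The modification of \<open>\<eta>\<close> that is a supersolution on the whole plane.\<close>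
  define f where "f p = (if fst p \<le> snd p then if eternal_survival p = 0 then 0 else e p else \<top>)" for p
  have [measurable]: "fst \<in> borel_measurable (borel :: (real \<times> real) measure)"
    "snd \<in> borel_measurable (borel :: (real \<times> real) measure)" by (simp_all add: borel_prod[symmetric])
  have f[measurable]: "f \<in> borel_measurable borel" unfolding f_def[abs_def] by measurable
  have "ereal a < Liminf (at (\<infinity>, \<infinity>)) (\<lambda>p. ereal (\<eta> p))"
    by (rule less_le_trans[OF _ liminf]) (use a in \<open>simp add: one_ereal_def\<close>)
  then obtain c where c: "\<And>u v. c \<le> u \<Longrightarrow> c \<le> v \<Longrightarrow> a < \<eta> (ereal u, ereal v)"
    by (rule Liminf_at_infinity_bound) blast
  have "ennreal a * eternal_survival (u, v) \<le> f (u, v)"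
  proof (rule eternal_survival_le_supersolution[OF f])
    show "killed_step f p \<le> f p" for p
    proof -
      consider "snd p < fst p" | "fst p \<le> snd p" "eternal_survival p = 0" | "fst p \<le> snd p" "eternal_survival p \<noteq> 0"
        by fastforce
      then show ?thesis
      proof cases
        case 1 then show ?thesis by (simp add: f_def)
      next
        case 2
        let ?next = "\<lambda>\<omega>. (min (fst p - U \<omega>) (snd p - V \<omega>), snd p - V \<omega>)"
        from 2 have "killed_step eternal_survival p = 0" by (simp add: killed_step_eternal_survival)
        then have "AE \<omega> in M. indicator {..fst p} (U \<omega>) * eternal_survival (?next \<omega>) = 0"
          unfolding killed_step_def by (subst (asm) nn_integral_0_iff_AE) auto
        then have "AE \<omega> in M. indicator {..fst p} (U \<omega>) * f (?next \<omega>) = 0"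
          by eventually_elim (auto simp: f_def)
        then have "killed_step f p = 0"
          unfolding killed_step_def by (subst nn_integral_0_iff_AE) auto
        then show ?thesis by simp
      next
        case 3
        have "killed_step f p \<le> killed_step e p"
          unfolding killed_step_def by (intro nn_integral_mono mult_left_mono) (auto simp: f_def)
        also have "killed_step e p \<le> e p"
        proof -
          have "enn2ereal (killed_step e p) \<le> ereal (\<eta> (ereal (fst p), ereal (snd p)))"
            using drift[of "fst p" "snd p"] 3 nonneg
            by (simp only: ext_expectation_next_state e_def) simp
          then show ?thesis using nonneg by (simp add: e_def less_eq_ennreal.rep_eq)
        qed
        finally show ?thesis using 3 by (simp add: f_def)
      qed
    qed
    show "ennreal a * eternal_survival p \<le> f p + ennreal (exp (\<theta> * c)) * lyap p" for p
    proof -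
      have le: "ennreal a * eternal_survival p \<le> ennreal a * 1"
        by (intro mult_left_mono eternal_survival_le_1) auto
      show ?thesis
      proof (cases "c \<le> fst p \<and> c \<le> snd p")
        case True
        then have "ennreal a \<le> e p" unfolding e_def
          by (intro ennreal_leI less_imp_le[OF c]) auto
        with le have "ennreal a * eternal_survival p \<le> f p" by (auto simp: f_def)
        then show ?thesis by (rule order_trans) simp
      next
        case False
        note le
        also have "ennreal a * 1 \<le> 1" using a by simp
        also have "1 \<le> ennreal (exp (\<theta> * c)) * lyap p"
          using one_le_lyap[of "fst p" c "snd p"] False by auto
        finally show ?thesis by (rule order_trans) simp
      qed
    qed
  qed auto
  also have "f (u, v) \<le> e (u, v)" using \<open>u \<le> v\<close> by (simp add: f_def)
  finally show "ennreal a * eternal_survival (u, v) \<le> ennreal (\<eta> (ereal u, ereal v))" by (simp add: e_def)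
qed

end

section \<open>Survival along a list of independent jobs\<close>

lemma (in prob_space) nn_integral_indep_pair:
  assumes ind: "indep_var N1 A N2 B" and f[measurable]: "f \<in> borel_measurable (N1 \<Otimes>\<^sub>M N2)"
  shows "(\<integral>\<^sup>+ \<omega>. f (A \<omega>, B \<omega>) \<partial>M) = (\<integral>\<^sup>+ \<omega>. \<integral>\<^sup>+ \<omega>'. f (A \<omega>, B \<omega>') \<partial>M \<partial>M)"
proof -
  have A[measurable]: "A \<in> measurable M N1" and B[measurable]: "B \<in> measurable M N2"
    and eq: "distr M N1 A \<Otimes>\<^sub>M distr M N2 B = distr M (N1 \<Otimes>\<^sub>M N2) (\<lambda>\<omega>. (A \<omega>, B \<omega>))"
    using ind unfolding indep_var_distribution_eq by auto
  interpret B: prob_space "distr M N2 B" by (rule prob_space_distr) measurable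
  have "(\<integral>\<^sup>+ \<omega>. f (A \<omega>, B \<omega>) \<partial>M) = (\<integral>\<^sup>+ x. f x \<partial>(distr M N1 A \<Otimes>\<^sub>M distr M N2 B))"
    by (simp add: eq nn_integral_distr)
  also have "\<dots> = (\<integral>\<^sup>+ x. \<integral>\<^sup>+ y. f (x, y) \<partial>distr M N2 B \<partial>distr M N1 A)"
    by (rule B.nn_integral_fst[symmetric]) simp
  also have "\<dots> = (\<integral>\<^sup>+ \<omega>. \<integral>\<^sup>+ y. f (A \<omega>, y) \<partial>distr M N2 B \<partial>M)"
    by (rule nn_integral_distr) (auto intro!: B.borel_measurable_nn_integral)
  also have "\<dots> = (\<integral>\<^sup>+ \<omega>. \<integral>\<^sup>+ \<omega>'. f (A \<omega>, B \<omega>') \<partial>M \<partial>M)"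
    by (intro nn_integral_cong nn_integral_distr) (auto dest: measurable_space[OF A])
  finally show ?thesis .
qed

lemma nn_integral_of_bool:
  assumes [measurable]: "Measurable.pred M P"
  shows "(\<integral>\<^sup>+ \<omega>. of_bool (P \<omega>) \<partial>M) = emeasure M {\<omega> \<in> space M. P \<omega>}"
proof -
  have "(\<integral>\<^sup>+ \<omega>. of_bool (P \<omega>) \<partial>M) = (\<integral>\<^sup>+ \<omega>. indicator {\<omega> \<in> space M. P \<omega>} \<omega> \<partial>M)"
    by (intro nn_integral_cong) (simp add: indicator_def)
  then show ?thesis by simp
qed

text \<open>
  Survival of the killed chain whose steps are taken in the order given by a list.  Lists allow
  the same statement to serve both \<open>T\<^sup>1, T\<^sup>2\<close>, where the steps are \<open>1, 2, ...\<close>, and the queue, where time is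
  reversed.
\<close>

fun survives :: "(nat \<Rightarrow> real) \<Rightarrow> (nat \<Rightarrow> real) \<Rightarrow> nat list \<Rightarrow> real \<Rightarrow> real \<Rightarrow> bool" where
  "survives a b [] u v \<longleftrightarrow> True"
| "survives a b (k # ks) u v \<longleftrightarrow> a k \<le> u \<and> survives a b ks (min (u - a k) (v - b k)) (v - b k)"

lemma measurable_survives [measurable (raw)]:
  assumes "\<And>k. k \<in> set ks \<Longrightarrow> (\<lambda>x. a x k) \<in> borel_measurable N"
    and "\<And>k. k \<in> set ks \<Longrightarrow> (\<lambda>x. b x k) \<in> borel_measurable N"
    and "f \<in> borel_measurable N" "g \<in> borel_measurable N"
  shows "Measurable.pred N (\<lambda>x. survives (a x) (b x) ks (f x) (g x))"
  using assms
proof (induction ks arbitrary: f g)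
  case (Cons k ks)
  have [measurable]: "(\<lambda>x. a x k) \<in> borel_measurable N" "(\<lambda>x. b x k) \<in> borel_measurable N"
    "f \<in> borel_measurable N" "g \<in> borel_measurable N"
    using Cons.prems by auto
  have [measurable]: "Measurable.pred N (\<lambda>x. survives (a x) (b x) ks (min (f x - a x k) (g x - b x k)) (g x - b x k))"
    by (intro Cons.IH) (use Cons.prems in auto)
  show ?case by simp
qed simp

lemma survives_cong:
  "(\<And>k. k \<in> set ks \<Longrightarrow> a k = a' k) \<Longrightarrow> (\<And>k. k \<in> set ks \<Longrightarrow> b k = b' k) \<Longrightarrow>
    survives a b ks u v = survives a' b' ks u v"
  by (induction ks arbitrary: u v) auto

lemma all_nat_interval_Suc:
  "(\<forall>j. 1 \<le> j \<and> j \<le> Suc n \<longrightarrow> P j) \<longleftrightarrow> P 1 \<and> (\<forall>j. 1 \<le> j \<and> j \<le> n \<longrightarrow> P (Suc j))"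
  by (metis One_nat_def Suc_le_mono le0 le_SucE le_zero_eq not0_implies_Suc le_SucI)

lemma all_nat_pairs_Suc:
  "(\<forall>i j. 1 \<le> i \<and> i < j \<and> j \<le> Suc n \<longrightarrow> P i j) \<longleftrightarrow>
    (\<forall>j. 1 \<le> j \<and> j \<le> n \<longrightarrow> P 1 (Suc j)) \<and> (\<forall>i j. 1 \<le> i \<and> i < j \<and> j \<le> n \<longrightarrow> P (Suc i) (Suc j))"
  (is "?L \<longleftrightarrow> ?R")
proof
  assume R: ?R
  show ?L
  proof (intro allI impI)
    fix i j assume ij: "1 \<le> i \<and> i < j \<and> j \<le> Suc n"
    then obtain i' j' where "i = Suc i'" "j = Suc j'" by (cases i; cases j) auto
    with ij R show "P i j" by (cases i') auto
  qed
qed auto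

text \<open>
  Unrolling the minimum in the transition yields one bound by \<open>u\<close> for each sum of steps \<open>a\<close>, and one
  bound by \<open>v\<close> for each sum that switches once from steps \<open>b\<close> to steps \<open>a\<close>; the suprema \<open>T\<^sup>1\<close> and \<open>T\<^sup>2\<close>
  range over these sums.
\<close>

lemma survives_upt:
  "survives a b [s..<s + n] u v \<longleftrightarrow>
    (\<forall>j. 1 \<le> j \<and> j \<le> n \<longrightarrow> sum a {s..<s + j} \<le> u) \<and>
    (\<forall>i j. 1 \<le> i \<and> i < j \<and> j \<le> n \<longrightarrow> sum b {s..<s + i} + sum a {s + i..<s + j} \<le> v)"
proof (induction n arbitrary: s u v)
  case (Suc n)
  have upt: "[s..<s + Suc n] = s # [Suc s..<Suc s + n]" by (simp add: upt_rec)
  have split: "sum c {s..<s + Suc j} = c s + sum c {Suc s..<Suc s + j}" for c :: "nat \<Rightarrow> real" and j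
    by (simp add: sum.atLeast_Suc_lessThan)
  show ?case
    unfolding upt survives.simps Suc.IH all_nat_interval_Suc all_nat_pairs_Suc
    unfolding split by (auto simp: le_diff_eq algebra_simps)
qed auto

context tandem_queue
begin

abbreviation coord :: "nat + nat + nat \<Rightarrow> 'a \<Rightarrow> real" where
  "coord \<equiv> case_sum X (case_sum Y Z)"

lemma measurable_coord [measurable]: "coord i \<in> borel_measurable M"
  using indep unfolding indep_vars_def by auto

lemma measurable_X [measurable]: "X n \<in> borel_measurable M" using measurable_coord[of "Inl n"] by simp
lemma measurable_Y [measurable]: "Y n \<in> borel_measurable M" using measurable_coord[of "Inr (Inl n)"] by simp
lemma measurable_Z [measurable]: "Z n \<in> borel_measurable M" using measurable_coord[of "Inr (Inr n)"] by simp

lemma nn_integral_blocks: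
  assumes "A \<inter> B = {}"
    and "f \<in> borel_measurable (PiM A (\<lambda>_. borel) \<Otimes>\<^sub>M PiM B (\<lambda>_. borel))"
  shows "(\<integral>\<^sup>+ \<omega>. f (\<lambda>i\<in>A. coord i \<omega>, \<lambda>i\<in>B. coord i \<omega>) \<partial>M) =
    (\<integral>\<^sup>+ \<omega>. \<integral>\<^sup>+ \<omega>'. f (\<lambda>i\<in>A. coord i \<omega>, \<lambda>i\<in>B. coord i \<omega>') \<partial>M \<partial>M)"
  by (rule nn_integral_indep_pair[OF indep_var_restrict[OF indep assms(1)] assms(2)]) auto

abbreviation triple :: "nat + nat + nat \<Rightarrow> nat + nat + nat \<Rightarrow> nat + nat + nat \<Rightarrow> 'a \<Rightarrow> real \<times> real \<times> real" where
  "triple i j l \<omega> \<equiv> (coord i \<omega>, coord j \<omega>, coord l \<omega>)"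

text \<open>
  Random variables with distinct indices are independent, so the integral is an iterated one.
\<close>

lemma nn_integral_triple:
  assumes "i \<noteq> j" "i \<noteq> l" "j \<noteq> l"
    and [measurable]: "f \<in> borel_measurable (borel \<Otimes>\<^sub>M borel \<Otimes>\<^sub>M borel)"
  shows "(\<integral>\<^sup>+ \<omega>. f (triple i j l \<omega>) \<partial>M) =
    (\<integral>\<^sup>+ x. \<integral>\<^sup>+ y. \<integral>\<^sup>+ z. f (x, y, z) \<partial>distr M borel (coord l) \<partial>distr M borel (coord j) \<partial>distr M borel (coord i))"
proof -
  interpret l: prob_space "distr M borel (coord l)" by (rule prob_space_distr) simp
  interpret j: prob_space "distr M borel (coord j)" by (rule prob_space_distr) simp
  have "(\<integral>\<^sup>+ \<omega>. f (triple i j l \<omega>) \<partial>M) = (\<integral>\<^sup>+ \<omega>. \<integral>\<^sup>+ \<omega>'. f (coord i \<omega>, coord j \<omega>', coord l \<omega>') \<partial>M \<partial>M)"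
    using nn_integral_blocks[of "{i}" "{j, l}" "\<lambda>(c, c'). f (c i, c' j, c' l)"] assms(1-3) by simp
  also have "\<dots> = (\<integral>\<^sup>+ \<omega>. \<integral>\<^sup>+ \<omega>'. \<integral>\<^sup>+ \<omega>''. f (coord i \<omega>, coord j \<omega>', coord l \<omega>'') \<partial>M \<partial>M \<partial>M)"
    using nn_integral_blocks[of "{j}" "{l}" "\<lambda>(c, c'). f (coord i \<omega>, c j, c' l)" for \<omega>] assms(1-3) by simp
  also have "\<dots> = (\<integral>\<^sup>+ x. \<integral>\<^sup>+ y. \<integral>\<^sup>+ z. f (x, y, z) \<partial>distr M borel (coord l) \<partial>distr M borel (coord j) \<partial>distr M borel (coord i))"
    by (simp add: nn_integral_distr)
  finally show ?thesis .
qed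

lemma nn_integral_triple_cong:
  assumes "i \<noteq> j" "i \<noteq> l" "j \<noteq> l" and "i' \<noteq> j'" "i' \<noteq> l'" "j' \<noteq> l'"
    and "distr M borel (coord i) = distr M borel (coord i')"
    and "distr M borel (coord j) = distr M borel (coord j')"
    and "distr M borel (coord l) = distr M borel (coord l')"
    and "f \<in> borel_measurable (borel \<Otimes>\<^sub>M borel \<Otimes>\<^sub>M borel)"
  shows "(\<integral>\<^sup>+ \<omega>. f (triple i j l \<omega>) \<partial>M) = (\<integral>\<^sup>+ \<omega>. f (triple i' j' l' \<omega>) \<partial>M)"
  using assms by (simp only: nn_integral_triple not_False_eq_True)

abbreviation U :: "nat \<Rightarrow> 'a \<Rightarrow> real" where "U n \<omega> \<equiv> Y n \<omega> - X n \<omega>"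
abbreviation V :: "nat \<Rightarrow> 'a \<Rightarrow> real" where "V n \<omega> \<equiv> Z n \<omega> - X n \<omega>"

sublocale walk: killed_walk M "U 1" "V 1"
  by unfold_locales auto

abbreviation survives_at :: "nat list \<Rightarrow> real \<Rightarrow> real \<Rightarrow> 'a \<Rightarrow> bool" where
  "survives_at ks u v \<omega> \<equiv> survives (\<lambda>k. U k \<omega>) (\<lambda>k. V k \<omega>) ks u v"

definition block :: "nat list \<Rightarrow> (nat + nat + nat) set" where
  "block ks = (\<Union>k\<in>set ks. {Inl k, Inr (Inl k), Inr (Inr k)})"

text \<open>
  The indices \<open>i, j, l\<close> refer to variables outside the jobs in \<open>ks\<close>.  By independence, one can
  condition on them and use the survival probability from a fixed state.
\<close>

lemma emeasure_survives_random_start: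
  assumes surv: "\<And>u v. emeasure M {\<omega> \<in> space M. survives_at ks u v \<omega>} = walk.survival (length ks) (u, v)"
    and out: "i \<notin> block ks" "j \<notin> block ks" "l \<notin> block ks"
    and Q[measurable]: "Measurable.pred (borel \<Otimes>\<^sub>M borel \<Otimes>\<^sub>M borel) Q"
    and f[measurable]: "f \<in> borel_measurable (borel \<Otimes>\<^sub>M borel \<Otimes>\<^sub>M borel)"
    and g[measurable]: "g \<in> borel_measurable (borel \<Otimes>\<^sub>M borel \<Otimes>\<^sub>M borel)"
  shows "emeasure M {\<omega> \<in> space M. Q (triple i j l \<omega>) \<and>
      survives_at ks (f (triple i j l \<omega>)) (g (triple i j l \<omega>)) \<omega>} =
    (\<integral>\<^sup>+ \<omega>. of_bool (Q (triple i j l \<omega>)) * walk.survival (length ks) (f (triple i j l \<omega>), g (triple i j l \<omega>)) \<partial>M)"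
proof -
  define S where "S c = survives (\<lambda>k. c (Inr (Inl k)) - c (Inl k)) (\<lambda>k. c (Inr (Inr k)) - c (Inl k)) ks"
    for c :: "nat + nat + nat \<Rightarrow> real"
  have S: "S (\<lambda>i\<in>block ks. coord i \<omega>) u v = survives_at ks u v \<omega>" for \<omega> u v
    unfolding S_def by (rule survives_cong) (auto simp: block_def)
  define P where "P = (\<lambda>(t, c). of_bool (Q (t i, t j, t l) \<and> S c (f (t i, t j, t l)) (g (t i, t j, t l))) :: ennreal)"
  have "P \<in> borel_measurable (PiM {i, j, l} (\<lambda>_. borel) \<Otimes>\<^sub>M PiM (block ks) (\<lambda>_. borel))"
  proof -
    have *: "k \<in> set ks \<Longrightarrow> Inl k \<in> block ks" "k \<in> set ks \<Longrightarrow> Inr (Inl k) \<in> block ks"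
      "k \<in> set ks \<Longrightarrow> Inr (Inr k) \<in> block ks" for k by (auto simp: block_def)
    have [measurable]: "Measurable.pred (PiM {i, j, l} (\<lambda>_. borel) \<Otimes>\<^sub>M PiM (block ks) (\<lambda>_. borel))
      (\<lambda>x. S (snd x) (f (fst x i, fst x j, fst x l)) (g (fst x i, fst x j, fst x l)))"
      unfolding S_def
      by (rule measurable_survives) (auto intro: * intro!: borel_measurable_diff
         measurable_compose[OF measurable_snd measurable_component_singleton])
    show ?thesis unfolding P_def case_prod_beta of_bool_def by measurable
  qed
  from nn_integral_blocks[OF _ this] out
  have "(\<integral>\<^sup>+ \<omega>. of_bool (Q (triple i j l \<omega>) \<and>
      survives_at ks (f (triple i j l \<omega>)) (g (triple i j l \<omega>)) \<omega>) \<partial>M) =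
    (\<integral>\<^sup>+ \<omega>. \<integral>\<^sup>+ \<omega>'. of_bool (Q (triple i j l \<omega>) \<and>
      survives_at ks (f (triple i j l \<omega>)) (g (triple i j l \<omega>)) \<omega>') \<partial>M \<partial>M)"
    by (simp add: P_def S)
  also have "\<dots> = (\<integral>\<^sup>+ \<omega>. of_bool (Q (triple i j l \<omega>)) * walk.survival (length ks) (f (triple i j l \<omega>), g (triple i j l \<omega>)) \<partial>M)"
  proof (rule nn_integral_cong)
    fix \<omega>
    show "(\<integral>\<^sup>+ \<omega>'. of_bool (Q (triple i j l \<omega>) \<and>
        survives_at ks (f (triple i j l \<omega>)) (g (triple i j l \<omega>)) \<omega>') \<partial>M) =
      of_bool (Q (triple i j l \<omega>)) * walk.survival (length ks) (f (triple i j l \<omega>), g (triple i j l \<omega>))"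
      by (cases "Q (triple i j l \<omega>)") (simp_all add: nn_integral_of_bool surv)
  qed
  finally show ?thesis by (subst (asm) nn_integral_of_bool) simp_all
qed

text \<open>
  The first step is taken by a job that is independent of the remaining ones, so it acts as a
  random start for them.
\<close>

lemma emeasure_survives:
  assumes "distinct ks"
  shows "emeasure M {\<omega> \<in> space M. survives_at ks u v \<omega>} = walk.survival (length ks) (u, v)"
  using assms
proof (induction ks arbitrary: u v)
  case Nil
  then show ?case by (simp add: emeasure_space_1 del: One_nat_def)
next
  case (Cons k ks)
  define i j l where ijl: "i = (Inl :: _ \<Rightarrow> nat + nat + nat)" "j = (\<lambda>k. Inr (Inl k) :: nat + nat + nat)"
    "l = (\<lambda>k. Inr (Inr k) :: nat + nat + nat)"
  define F where "F = (\<lambda>(x, y, z). of_bool (y - x \<le> u) *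
    walk.survival (length ks) (min (u - (y - x)) (v - (z - x)), v - (z - x)))"
  have [measurable]: "walk.survival (length ks) \<in> borel_measurable (borel \<Otimes>\<^sub>M borel)"
    using walk.measurable_survival by (simp only: borel_prod)
  have Fm: "F \<in> borel_measurable (borel \<Otimes>\<^sub>M borel \<Otimes>\<^sub>M borel)"
    unfolding F_def case_prod_beta of_bool_def by measurable
  have "emeasure M {\<omega> \<in> space M. survives_at (k # ks) u v \<omega>} =
     emeasure M {\<omega> \<in> space M. (\<lambda>(x, y, z). y - x \<le> u) (triple (i k) (j k) (l k) \<omega>) \<and>
       survives_at ks ((\<lambda>(x, y, z). min (u - (y - x)) (v - (z - x))) (triple (i k) (j k) (l k) \<omega>))
        ((\<lambda>(x, y, z). v - (z - x)) (triple (i k) (j k) (l k) \<omega>)) \<omega>}"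
    by (simp add: ijl)
  also have "\<dots> = (\<integral>\<^sup>+ \<omega>. F (triple (i k) (j k) (l k) \<omega>) \<partial>M)"
    unfolding F_def
    by (subst emeasure_survives_random_start) (use Cons in \<open>auto simp: ijl block_def case_prod_beta\<close>)
  also have "\<dots> = (\<integral>\<^sup>+ \<omega>. F (triple (i 1) (j 1) (l 1) \<omega>) \<partial>M)"
    by (rule nn_integral_triple_cong[OF _ _ _ _ _ _ _ _ _ Fm])
       (auto simp: ijl intro: ident_X ident_Y ident_Z)
  also have "\<dots> = walk.survival (length (k # ks)) (u, v)"
    by (simp add: walk.survival_Suc walk.killed_step_def F_def ijl indicator_def of_bool_def del: One_nat_def)
  finally show ?case .
qed

text \<open>
  Survival of \<open>n\<close> steps means that the truncated suprema are at most \<open>u\<close> and \<open>v\<close>; these events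
  decrease to the event for \<open>T\<^sup>1\<close> and \<open>T\<^sup>2\<close>.
\<close>

lemma joint_cdf_T_eq_eternal_survival:
  "ennreal (joint_cdf_T M U V (ereal u, ereal v)) = walk.eternal_survival (u, v)"
proof -
  have sur: "(\<forall>n. survives_at [1..<1 + n] u v \<omega>) \<longleftrightarrow> T1 U \<omega> \<le> ereal u \<and> T2 U V \<omega> \<le> ereal v" for \<omega>
  proof -
    have "T1 U \<omega> \<le> ereal u \<longleftrightarrow> (\<forall>j. 1 \<le> j \<longrightarrow> sum (\<lambda>k. U k \<omega>) {1..<1 + j} \<le> u)"
      by (auto simp: T1_def SUP_le_iff atLeastLessThanSuc_atLeastAtMost)
    moreover have "T2 U V \<omega> \<le> ereal v \<longleftrightarrow> (\<forall>i j. 1 \<le> i \<and> i < j \<longrightarrow>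
        sum (\<lambda>k. V k \<omega>) {1..<1 + i} + sum (\<lambda>k. U k \<omega>) {1 + i..<1 + j} \<le> v)"
      by (auto simp: T2_def SUP_le_iff atLeastLessThanSuc_atLeastAtMost)
    moreover have "(\<forall>n. (\<forall>j. 1 \<le> j \<and> j \<le> n \<longrightarrow> P j) \<and> (\<forall>i j. 1 \<le> i \<and> i < j \<and> j \<le> n \<longrightarrow> R i j)) \<longleftrightarrow>
        (\<forall>j. 1 \<le> j \<longrightarrow> P j) \<and> (\<forall>i j. 1 \<le> i \<and> i < j \<longrightarrow> R i j)" for P :: "nat \<Rightarrow> bool" and R
      using order_refl by meson
    ultimately show ?thesis by (simp only: survives_upt)
  qed
  have "(\<lambda>n. emeasure M {\<omega> \<in> space M. survives_at [1..<1 + n] u v \<omega>}) \<longlonglongrightarrow>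
    emeasure M (\<Inter>n. {\<omega> \<in> space M. survives_at [1..<1 + n] u v \<omega>})"
  proof (rule Lim_emeasure_decseq)
    show "decseq (\<lambda>n. {\<omega> \<in> space M. survives_at [1..<1 + n] u v \<omega>})"
      unfolding decseq_def survives_upt by auto
  qed auto
  moreover have "emeasure M {\<omega> \<in> space M. survives_at [1..<1 + n] u v \<omega>} = walk.survival n (u, v)" for n
    by (subst emeasure_survives) (simp_all only: distinct_upt length_upt add_diff_cancel_left')
  ultimately have "walk.eternal_survival (u, v) = emeasure M (\<Inter>n. {\<omega> \<in> space M. survives_at [1..<1 + n] u v \<omega>})"
    using LIMSEQ_unique[OF walk.survival_tendsto] by simp
  also have "(\<Inter>n. {\<omega> \<in> space M. survives_at [1..<1 + n] u v \<omega>}) =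
    {\<omega> \<in> space M. T1 U \<omega> \<le> ereal u \<and> T2 U V \<omega> \<le> ereal v}"
    using sur by auto
  finally show ?thesis by (simp add: joint_cdf_T_def emeasure_eq_measure)
qed

end

section \<open>Negative drift as an exponential moment\<close>

text \<open>
  The derivative of \<open>\<theta> \<mapsto> E exp (\<theta> f)\<close> at \<open>0\<close> from the right is \<open>E f < 0\<close>.  Taking \<open>\<theta>\<close> along the
  sequence \<open>a / (n + 1)\<close> yields an eventual statement, so one \<open>\<theta>\<close> can serve several random variables.
\<close>

lemma (in prob_space) exp_moment_below_1_of_negative_mean:
  fixes f :: "'a \<Rightarrow> real" and a :: real
  assumes f: "integrable M f" and a: "0 < a" and fa: "integrable M (\<lambda>\<omega>. exp (a * f \<omega>))"
    and neg: "expectation f < 0"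
  shows "eventually (\<lambda>n. integrable M (\<lambda>\<omega>. exp (a / Suc n * f \<omega>)) \<and>
     expectation (\<lambda>\<omega>. exp (a / Suc n * f \<omega>)) < 1) sequentially"
proof -
  have [measurable]: "f \<in> borel_measurable M" using f by simp
  define q where "q n x = (exp (a / Suc n * x) - 1) / (a / Suc n)" for n and x :: real
  have t0: "(\<lambda>n. a / Suc n) \<longlonglongrightarrow> 0"
    using LIMSEQ_Suc[OF lim_const_over_n[of a]] by simp
  have tp: "a / Suc n > 0" for n using a by simp
  have conv: "(\<lambda>n. q n x) \<longlonglongrightarrow> x" for x
  proof -
    have "((\<lambda>t. exp (t * x)) has_real_derivative x) (at 0)"
      by (auto intro!: derivative_eq_intros)
    then have "(\<lambda>t. (exp (t * x) - 1) / t) \<midarrow>0\<rightarrow> x"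
      by (simp add: DERIV_def)
    then show ?thesis unfolding q_def
      by (rule filterlim_compose) (use t0 tp in \<open>auto simp: filterlim_at eventually_sequentially intro!: exI[of _ 0] simp del: of_nat_Suc\<close>)
  qed
  have lower: "x \<le> q n x" for n x
  proof -
    have "a / Suc n * x \<le> exp (a / Suc n * x) - 1"
      using exp_ge_add_one_self[of "a / Suc n * x"] by linarith
    then show ?thesis unfolding q_def using tp[of n] by (simp only: pos_le_divide_eq mult.commute)
  qed
  \<comment> \<open>Convexity of the exponential function bounds every difference quotient by the one at \<open>a\<close>.\<close>
  have upper: "q n x \<le> (exp (a * x) - 1) / a" for n x
  proof -
    define t :: real where "t = 1 / Suc n"
    have t: "0 < t" "t \<le> 1" by (auto simp: t_def)
    have "exp ((1 - t) *\<^sub>R 0 + t *\<^sub>R (a * x)) \<le> (1 - t) * exp 0 + t * exp (a * x)"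
      using t by (intro convex_onD[OF exp_convex]) auto
    then have "exp (t * a * x) - 1 \<le> t * (exp (a * x) - 1)"
      by (simp add: algebra_simps)
    then have "(exp (t * a * x) - 1) / (t * a) \<le> t * (exp (a * x) - 1) / (t * a)"
      using t a by (intro divide_right_mono) auto
    then show ?thesis using t a by (simp add: q_def t_def)
  qed
  have bnd: "norm (q n x) \<le> \<bar>x\<bar> + exp (a * x) / a + 1 / a" for n x
  proof -
    have "(exp (a * x) - 1) / a \<le> exp (a * x) / a" "0 \<le> exp (a * x) / a" "0 \<le> 1 / a" using a by (auto simp: divide_simps)
    with lower[of x n] upper[of n x] show ?thesis unfolding real_norm_def by linarith
  qed
  have qm[measurable]: "(\<lambda>\<omega>. q n (f \<omega>)) \<in> borel_measurable M" for n unfolding q_def by measurable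
  have dom: "integrable M (\<lambda>\<omega>. \<bar>f \<omega>\<bar> + exp (a * f \<omega>) / a + 1 / a)"
    using f fa by auto
  have lim: "(\<lambda>n. expectation (\<lambda>\<omega>. q n (f \<omega>))) \<longlonglongrightarrow> expectation f"
    by (rule integral_dominated_convergence[where w="\<lambda>\<omega>. \<bar>f \<omega>\<bar> + exp (a * f \<omega>) / a + 1 / a"])
       (use dom conv bnd in auto)
  have qi: "integrable M (\<lambda>\<omega>. q n (f \<omega>))" for n
    by (rule Bochner_Integration.integrable_bound[OF dom]) (auto intro!: AE_I2 intro: order_trans[OF bnd[unfolded real_norm_def] abs_ge_self])
  have eq: "exp (a / Suc n * x) = a / Suc n * q n x + 1" for n x
    using a by (simp add: q_def)
  have int: "integrable M (\<lambda>\<omega>. exp (a / Suc n * f \<omega>))" for n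
    unfolding eq using qi by simp
  have ev: "expectation (\<lambda>\<omega>. exp (a / Suc n * f \<omega>)) = a / Suc n * expectation (\<lambda>\<omega>. q n (f \<omega>)) + 1" for n
    unfolding eq using qi by (simp add: prob_space)
  have "eventually (\<lambda>n. expectation (\<lambda>\<omega>. q n (f \<omega>)) < 0) sequentially"
    using order_tendstoD(2)[OF lim neg] .
  then show ?thesis
  proof eventually_elim
    case (elim n)
    have "a / Suc n * expectation (\<lambda>\<omega>. q n (f \<omega>)) < 0"
      using elim tp[of n] by (rule mult_pos_neg[rotated])
    then show ?case using int ev by simp
  qed
qed

text \<open>
  \<open>X\<close> may have infinite mean.  It is truncated at a level \<open>N\<close> that leaves the mean of the
  difference negative; truncation only increases the exponential moment.
\<close>

lemma (in prob_space) exp_moment_difference_below_1: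
  fixes S X :: "'a \<Rightarrow> real"
  assumes [measurable]: "X \<in> borel_measurable M" "S \<in> borel_measurable M"
    and X: "AE \<omega> in M. 0 \<le> X \<omega>" and S: "AE \<omega> in M. 0 \<le> S \<omega>"
    and a: "0 < a" and aS: "integrable M (\<lambda>\<omega>. exp (a * S \<omega>))"
    and less: "(\<integral>\<^sup>+ \<omega>. ennreal (S \<omega>) \<partial>M) < (\<integral>\<^sup>+ \<omega>. ennreal (X \<omega>) \<partial>M)"
  shows "eventually (\<lambda>n. (\<integral>\<^sup>+ \<omega>. ennreal (exp (a / Suc n * (S \<omega> - X \<omega>))) \<partial>M) < 1) sequentially"
proof -
  have "(\<lambda>n. \<integral>\<^sup>+ \<omega>. ennreal (min (X \<omega>) (real n)) \<partial>M) \<longlonglongrightarrow> (\<integral>\<^sup>+ \<omega>. ennreal (X \<omega>) \<partial>M)"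
  proof (rule nn_integral_LIMSEQ)
    show "incseq (\<lambda>n \<omega>. ennreal (min (X \<omega>) (real n)))"
      by (auto simp: incseq_def le_fun_def intro!: ennreal_leI)
    show "(\<lambda>n. ennreal (min (X \<omega>) (real n))) \<longlonglongrightarrow> ennreal (X \<omega>)" for \<omega>
    proof (rule tendsto_eventually)
      obtain N :: nat where "X \<omega> \<le> real N" using real_arch_simple by blast
      then show "eventually (\<lambda>n. ennreal (min (X \<omega>) (real n)) = ennreal (X \<omega>)) sequentially"
        by (intro eventually_sequentiallyI[of N]) (auto simp: min_def)
    qed
  qed simp
  from order_tendstoD(1)[OF this less] obtain N :: nat
    where N: "(\<integral>\<^sup>+ \<omega>. ennreal (S \<omega>) \<partial>M) < (\<integral>\<^sup>+ \<omega>. ennreal (min (X \<omega>) (real N)) \<partial>M)"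
    by (auto simp: eventually_sequentially)
  have Si: "integrable M S"
  proof (rule Bochner_Integration.integrable_bound[where f="\<lambda>\<omega>. exp (a * S \<omega>) / a"])
    show "AE \<omega> in M. norm (S \<omega>) \<le> norm (exp (a * S \<omega>) / a)"
      using S
    proof eventually_elim
      case (elim \<omega>)
      have "a * S \<omega> \<le> exp (a * S \<omega>)" using exp_ge_add_one_self[of "a * S \<omega>"] by linarith
      then show ?case using a elim by (simp add: field_simps)
    qed
  qed (use aS in auto)
  have Xi: "integrable M (\<lambda>\<omega>. min (X \<omega>) (real N))"
    by (rule Bochner_Integration.integrable_bound[where f="\<lambda>_. real N"])
       (use X in \<open>auto elim!: eventually_mono\<close>)
  have "expectation (\<lambda>\<omega>. S \<omega> - min (X \<omega>) (real N)) < 0"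
  proof -
    have X': "AE \<omega> in M. 0 \<le> min (X \<omega>) (real N)" using X by eventually_elim simp
    from N have "ennreal (expectation S) < ennreal (expectation (\<lambda>\<omega>. min (X \<omega>) (real N)))"
      by (simp add: nn_integral_eq_integral[OF Si S] nn_integral_eq_integral[OF Xi X'])
    then have "expectation S < expectation (\<lambda>\<omega>. min (X \<omega>) (real N))"
      using integral_nonneg_AE[OF S] by (simp add: ennreal_less_iff)
    then show ?thesis using Si Xi by simp
  qed
  moreover have "integrable M (\<lambda>\<omega>. exp (a * (S \<omega> - min (X \<omega>) (real N))))"
    by (rule Bochner_Integration.integrable_bound[OF aS])
       (use X in \<open>auto elim!: eventually_mono intro!: mult_left_mono simp: a less_imp_le\<close>)
  ultimately have "eventually (\<lambda>n. integrable M (\<lambda>\<omega>. exp (a / Suc n * (S \<omega> - min (X \<omega>) (real N)))) \<and>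
     expectation (\<lambda>\<omega>. exp (a / Suc n * (S \<omega> - min (X \<omega>) (real N)))) < 1) sequentially"
    by (intro exp_moment_below_1_of_negative_mean a) (use Si Xi in auto)
  then show ?thesis
  proof eventually_elim
    case (elim n)
    have "(\<integral>\<^sup>+ \<omega>. ennreal (exp (a / Suc n * (S \<omega> - X \<omega>))) \<partial>M) \<le>
      (\<integral>\<^sup>+ \<omega>. ennreal (exp (a / Suc n * (S \<omega> - min (X \<omega>) (real N)))) \<partial>M)"
      using a by (intro nn_integral_mono ennreal_leI) (auto intro!: divide_right_mono mult_left_mono)
    also have "\<dots> = ennreal (expectation (\<lambda>\<omega>. exp (a / Suc n * (S \<omega> - min (X \<omega>) (real N)))))"
      using elim by (intro nn_integral_eq_integral) auto
    also have "\<dots> < 1" using elim by (simp add: ennreal_less_one_iff)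
    finally show ?case .
  qed
qed

context tandem_queue
begin

lemma drifting_walk:
  obtains \<theta> r where "drifting_killed_walk M (U 1) (V 1) \<theta> r"
proof -
  obtain a where a: "0 < a" "integrable M (\<lambda>\<omega>. exp (a * Y 1 \<omega>))" "integrable M (\<lambda>\<omega>. exp (a * Z 1 \<omega>))"
    using light_tailed by auto
  have "eventually (\<lambda>n. (\<integral>\<^sup>+ \<omega>. ennreal (exp (a / Suc n * U 1 \<omega>)) \<partial>M) < 1 \<and>
      (\<integral>\<^sup>+ \<omega>. ennreal (exp (a / Suc n * V 1 \<omega>)) \<partial>M) < 1) sequentially"
    using stable a
    by (intro eventually_conj exp_moment_difference_below_1) (auto simp: nonneg_X nonneg_Y nonneg_Z)
  then obtain n where n: "(\<integral>\<^sup>+ \<omega>. ennreal (exp (a / Suc n * U 1 \<omega>)) \<partial>M) < 1"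
      "(\<integral>\<^sup>+ \<omega>. ennreal (exp (a / Suc n * V 1 \<omega>)) \<partial>M) < 1"
    by (auto simp: eventually_sequentially)
  define R where "R = max (\<integral>\<^sup>+ \<omega>. ennreal (exp (a / Suc n * U 1 \<omega>)) \<partial>M) (\<integral>\<^sup>+ \<omega>. ennreal (exp (a / Suc n * V 1 \<omega>)) \<partial>M)"
  have "R < 1" using n by (simp only: R_def max_less_iff_conj)
  then obtain r where r: "R = ennreal r" "0 \<le> r" "r < 1"
    by (cases R) (auto simp: ennreal_less_one_iff)
  have "drifting_killed_walk M (U 1) (V 1) (a / Suc n) r"
  proof
    show "(\<integral>\<^sup>+ \<omega>. ennreal (exp (a / Suc n * U 1 \<omega>)) \<partial>M) \<le> ennreal r"
      unfolding r(1)[symmetric] R_def by (rule max.cobounded1)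
    show "(\<integral>\<^sup>+ \<omega>. ennreal (exp (a / Suc n * V 1 \<omega>)) \<partial>M) \<le> ennreal r"
      unfolding r(1)[symmetric] R_def by (rule max.cobounded2)
  qed (use a r in auto)
  then show ?thesis by (rule that)
qed

end

section \<open>The tandem queue as a time-reversed killed chain\<close>

context tandem_queue
begin

definition first_queue_wait :: "nat \<Rightarrow> 'a \<Rightarrow> real" where
  "first_queue_wait n \<omega> = departure1 X Y n \<omega> - arrival X n \<omega> - Y n \<omega>"

text \<open>
  The time from the arrival of job \<open>n + 1\<close> until service of job \<open>n\<close> at the second queue begins
  (possibly negative).  Unlike a waiting time it is not cut off at \<open>0\<close>; together with \<open>first_queue_wait (n + 1)\<close>
  it is a Markovian state of the tandem.
\<close>

definition lag :: "nat \<Rightarrow> 'a \<Rightarrow> real" where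
  "lag n \<omega> = departure2 X Y Z n \<omega> - arrival X (Suc n) \<omega> - Z (Suc n) \<omega>"

lemma first_queue_wait_rec: "first_queue_wait 0 \<omega> = 0" "first_queue_wait (Suc n) \<omega> = max 0 (first_queue_wait n \<omega> + U n \<omega>)"
  by (auto simp: first_queue_wait_def arrival_def)

text \<open>
  The condition on \<open>Y 0\<close> removes the maximum with the departure time \<open>0\<close> of the fictitious job
  \<open>-1\<close>, which the first job meets at the second queue.
\<close>

lemma lag_rec:
  "0 \<le> Y 0 \<omega> \<Longrightarrow> lag 0 \<omega> = U 0 \<omega>"
  "lag (Suc n) \<omega> = max (first_queue_wait (Suc n) \<omega> + U (Suc n) \<omega>) (lag n \<omega> + V (Suc n) \<omega>)"
  by (simp_all add: lag_def first_queue_wait_def arrival_def max_def del: departure1.simps(2))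

lemma lag_le_iff:
  assumes "0 \<le> Y 0 \<omega>"
  shows "lag n \<omega> \<le> s \<longleftrightarrow> first_queue_wait n \<omega> \<le> s - U n \<omega> \<and> (case n of 0 \<Rightarrow> True | Suc m \<Rightarrow> lag m \<omega> \<le> s - V n \<omega>)"
  using assms by (cases n) (simp_all only: lag_rec first_queue_wait_rec(1) nat.case max.bounded_iff le_diff_eq, simp_all)

text \<open>
  Each Lindley step turns an upper bound on the state after job \<open>n\<close> into one on the state before it,
  and the new bounds are the next state of the killed chain.  The bound on \<open>first_queue_wait\<close> contains a
  maximum with \<open>0\<close>, hence the extra \<open>0 \<le> u\<close>, and only \<open>min u v\<close> matters for the chain, since
  \<open>lag\<close> is at least the first queue's random walk without that maximum.  The case distinction on \<open>n\<close>
  reflects that there is no lag before the first job.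
\<close>

lemma queue_state_le_iff_survives:
  assumes "0 \<le> Y 0 \<omega>"
  shows "first_queue_wait n \<omega> \<le> u \<and> (case n of 0 \<Rightarrow> True | Suc m \<Rightarrow> lag m \<omega> \<le> v) \<longleftrightarrow>
    0 \<le> u \<and> survives_at (rev [0..<n]) (min u v) v \<omega>"
proof (induction n arbitrary: u v)
  case (Suc n)
  have rev: "rev [0..<Suc n] = n # rev [0..<n]" by simp
  have "first_queue_wait (Suc n) \<omega> \<le> u \<and> lag n \<omega> \<le> v \<longleftrightarrow> 0 \<le> u \<and> first_queue_wait n \<omega> \<le> min u v - U n \<omega> \<and>
      (case n of 0 \<Rightarrow> True | Suc m \<Rightarrow> lag m \<omega> \<le> v - V n \<omega>)"
    unfolding lag_le_iff[OF assms] first_queue_wait_rec max.bounded_iff le_diff_eq min.bounded_iff by blast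
  also have "\<dots> \<longleftrightarrow> 0 \<le> u \<and> survives_at (rev [0..<Suc n]) (min u v) v \<omega>"
    unfolding Suc.IH rev survives.simps diff_ge_0_iff_ge by blast
  finally show ?case by (simp only: nat.case)
qed (simp add: first_queue_wait_rec)

text \<open>
  The sojourn time of job \<open>n\<close> is \<open>lag n + X\<^sub>n + Z\<^sub>n\<^sub>+\<^sub>1\<close>, and a bound on \<open>lag n\<close> is a bound on the state that
  job \<open>n\<close> finds.
\<close>

lemma sojourn_time_le_iff:
  assumes "0 \<le> Y 0 \<omega>"
  shows "sojourn_time X Y Z n \<omega> \<le> x \<longleftrightarrow> Z (Suc n) \<omega> + Y n \<omega> \<le> x \<and>
    survives_at (rev [0..<n]) (x - (Z (Suc n) \<omega> + max (Z n \<omega>) (Y n \<omega>))) (x - (Z (Suc n) \<omega> + Z n \<omega>)) \<omega>"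
proof -
  have "sojourn_time X Y Z n \<omega> \<le> x \<longleftrightarrow> lag n \<omega> \<le> x - X n \<omega> - Z (Suc n) \<omega>"
  proof -
    have "lag n \<omega> = sojourn_time X Y Z n \<omega> - X n \<omega> - Z (Suc n) \<omega>"
      by (simp add: sojourn_time_def lag_def arrival_def)
    then show ?thesis by linarith
  qed
  also have "\<dots> \<longleftrightarrow> first_queue_wait n \<omega> \<le> x - Y n \<omega> - Z (Suc n) \<omega> \<and>
      (case n of 0 \<Rightarrow> True | Suc m \<Rightarrow> lag m \<omega> \<le> x - (Z (Suc n) \<omega> + Z n \<omega>))"
  proof -
    have "x - X n \<omega> - Z (Suc n) \<omega> - U n \<omega> = x - Y n \<omega> - Z (Suc n) \<omega>"
      "x - X n \<omega> - Z (Suc n) \<omega> - V n \<omega> = x - (Z (Suc n) \<omega> + Z n \<omega>)" by simp_all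
    then show ?thesis by (subst lag_le_iff[OF assms]) (simp only:)
  qed
  also have "\<dots> \<longleftrightarrow> Z (Suc n) \<omega> + Y n \<omega> \<le> x \<and>
    survives_at (rev [0..<n]) (min (x - Y n \<omega> - Z (Suc n) \<omega>) (x - (Z (Suc n) \<omega> + Z n \<omega>))) (x - (Z (Suc n) \<omega> + Z n \<omega>)) \<omega>"
  proof -
    have "0 \<le> x - Y n \<omega> - Z (Suc n) \<omega> \<longleftrightarrow> Z (Suc n) \<omega> + Y n \<omega> \<le> x" by linarith
    then show ?thesis unfolding queue_state_le_iff_survives[OF assms] by (rule conj_cong) simp
  qed
  also have "min (x - Y n \<omega> - Z (Suc n) \<omega>) (x - (Z (Suc n) \<omega> + Z n \<omega>)) = x - (Z (Suc n) \<omega> + max (Z n \<omega>) (Y n \<omega>))"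
    by (simp add: min_def max_def)
  finally show ?thesis .
qed

lemma waiting_time_le_iff:
  assumes "0 \<le> Y 0 \<omega>"
  shows "waiting_time X Y Z n \<omega> \<le> x \<longleftrightarrow> 0 \<le> x \<and>
    survives_at (rev [0..<n]) (x - max (Z n \<omega> - Y n \<omega>) 0) (x - (Z n \<omega> - Y n \<omega>)) \<omega>"
proof -
  have *: "x + Y n \<omega> + Z (Suc n) \<omega> - (Z (Suc n) \<omega> + max (Z n \<omega>) (Y n \<omega>)) = x - max (Z n \<omega> - Y n \<omega>) 0"
    "x + Y n \<omega> + Z (Suc n) \<omega> - (Z (Suc n) \<omega> + Z n \<omega>) = x - (Z n \<omega> - Y n \<omega>)"
    by (simp_all add: max_def)
  have "waiting_time X Y Z n \<omega> \<le> x \<longleftrightarrow> sojourn_time X Y Z n \<omega> \<le> x + Y n \<omega> + Z (Suc n) \<omega>"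
    unfolding waiting_time_def by linarith
  moreover have "Z (Suc n) \<omega> + Y n \<omega> \<le> x + Y n \<omega> + Z (Suc n) \<omega> \<longleftrightarrow> 0 \<le> x" by linarith
  ultimately show ?thesis unfolding sojourn_time_le_iff[OF assms] * by blast
qed

lemma measurable_sojourn_time [measurable]: "sojourn_time X Y Z n \<in> borel_measurable M"
proof -
  have [measurable]: "arrival X n \<in> borel_measurable M" for n
    unfolding arrival_def[abs_def] by measurable
  have [measurable]: "departure1 X Y n \<in> borel_measurable M" for n
    by (induction n) auto
  have [measurable]: "departure2 X Y Z n \<in> borel_measurable M" for n
    by (induction n) auto
  show ?thesis unfolding sojourn_time_def[abs_def] by measurable
qed

lemma measurable_waiting_time [measurable]: "waiting_time X Y Z n \<in> borel_measurable M"
  unfolding waiting_time_def[abs_def] by measurable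

lemma ident_coord:
  "distr M borel (coord (Inl m)) = distr M borel (coord (Inl n))"
  "distr M borel (coord (Inr (Inl m))) = distr M borel (coord (Inr (Inl n)))"
  "distr M borel (coord (Inr (Inr m))) = distr M borel (coord (Inr (Inr n)))"
  by (simp_all only: sum.case) (rule ident_X ident_Y ident_Z)+

text \<open>
  The triple \<open>(Y\<^sub>n, Z\<^sub>n, Z\<^sub>n\<^sub>+\<^sub>1)\<close> is independent of jobs \<open>0, ..., n - 1\<close> and has the law of
  \<open>(Y\<^sub>1, Z\<^sub>2, Z\<^sub>1)\<close>.
\<close>

lemma emeasure_sojourn_time_le:
  "emeasure M {\<omega> \<in> space M. sojourn_time X Y Z n \<omega> \<le> x} =
    (\<integral>\<^sup>+ \<omega>. of_bool (Z 1 \<omega> + Y 1 \<omega> \<le> x) *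
      walk.survival n (x - (Z 1 \<omega> + max (Z 2 \<omega>) (Y 1 \<omega>)), x - (Z 1 \<omega> + Z 2 \<omega>)) \<partial>M)"
proof -
  define Q :: "real \<times> real \<times> real \<Rightarrow> bool" where "Q = (\<lambda>(y, z, z'). z' + y \<le> x)"
  define f :: "real \<times> real \<times> real \<Rightarrow> real" where "f = (\<lambda>(y, z, z'). x - (z' + max z y))"
  define g :: "real \<times> real \<times> real \<Rightarrow> real" where "g = (\<lambda>(y, z, z'). x - (z' + z))"
  have [measurable]: "Measurable.pred (borel \<Otimes>\<^sub>M borel \<Otimes>\<^sub>M borel) Q"
    unfolding Q_def case_prod_beta by measurable
  have [measurable]: "f \<in> borel_measurable (borel \<Otimes>\<^sub>M borel \<Otimes>\<^sub>M borel)"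
    unfolding f_def case_prod_beta by measurable
  have [measurable]: "g \<in> borel_measurable (borel \<Otimes>\<^sub>M borel \<Otimes>\<^sub>M borel)"
    unfolding g_def case_prod_beta by measurable
  have [measurable]: "walk.survival n \<in> borel_measurable (borel \<Otimes>\<^sub>M borel)"
    using walk.measurable_survival by (simp only: borel_prod)
  let ?T = "triple (Inr (Inl n)) (Inr (Inr n)) (Inr (Inr (Suc n)))"
  have "emeasure M {\<omega> \<in> space M. sojourn_time X Y Z n \<omega> \<le> x} =
    emeasure M {\<omega> \<in> space M. Q (?T \<omega>) \<and> survives_at (rev [0..<n]) (f (?T \<omega>)) (g (?T \<omega>)) \<omega>}"
  proof (rule emeasure_eq_AE)
    show "AE \<omega> in M. \<omega> \<in> {\<omega> \<in> space M. sojourn_time X Y Z n \<omega> \<le> x} \<longleftrightarrow>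
      \<omega> \<in> {\<omega> \<in> space M. Q (?T \<omega>) \<and> survives_at (rev [0..<n]) (f (?T \<omega>)) (g (?T \<omega>)) \<omega>}"
      using nonneg_Y[of 0] by eventually_elim (simp only: sojourn_time_le_iff Q_def f_def g_def prod.case mem_Collect_eq sum.case)
  qed measurable
  also have "\<dots> = (\<integral>\<^sup>+ \<omega>. of_bool (Q (?T \<omega>)) * walk.survival (length (rev [0..<n])) (f (?T \<omega>), g (?T \<omega>)) \<partial>M)"
    by (rule emeasure_survives_random_start[OF emeasure_survives, where Q=Q and f=f and g=g])
       (measurable, auto simp: block_def)
  also have "\<dots> = (\<integral>\<^sup>+ \<omega>. (\<lambda>t. of_bool (Q t) * walk.survival n (f t, g t)) (?T \<omega>) \<partial>M)"
    by (simp only: length_rev length_upt diff_zero)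
  also have "\<dots> = (\<integral>\<^sup>+ \<omega>. (\<lambda>t. of_bool (Q t) * walk.survival n (f t, g t))
      (triple (Inr (Inl 1)) (Inr (Inr 2)) (Inr (Inr 1)) \<omega>) \<partial>M)"
    by (rule nn_integral_triple_cong[OF _ _ _ _ _ _ ident_coord(2) ident_coord(3) ident_coord(3)])
       (simp_all only: of_bool_def sum.inject sum.distinct, measurable)
  finally show ?thesis by (simp only: Q_def f_def g_def prod.case sum.case)
qed

lemma emeasure_waiting_time_le:
  "emeasure M {\<omega> \<in> space M. waiting_time X Y Z n \<omega> \<le> x} =
    (\<integral>\<^sup>+ \<omega>. of_bool (0 \<le> x) *
      walk.survival n (x - max (Z 1 \<omega> - Y 1 \<omega>) 0, x - (Z 1 \<omega> - Y 1 \<omega>)) \<partial>M)"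
proof -
  define f :: "real \<times> real \<times> real \<Rightarrow> real" where "f = (\<lambda>(_, y, z). x - max (z - y) 0)"
  define g :: "real \<times> real \<times> real \<Rightarrow> real" where "g = (\<lambda>(_, y, z). x - (z - y))"
  have [measurable]: "f \<in> borel_measurable (borel \<Otimes>\<^sub>M borel \<Otimes>\<^sub>M borel)"
    unfolding f_def case_prod_beta by measurable
  have [measurable]: "g \<in> borel_measurable (borel \<Otimes>\<^sub>M borel \<Otimes>\<^sub>M borel)"
    unfolding g_def case_prod_beta by measurable
  have [measurable]: "walk.survival n \<in> borel_measurable (borel \<Otimes>\<^sub>M borel)"
    using walk.measurable_survival by (simp only: borel_prod)
  let ?T = "\<lambda>n. triple (Inl n) (Inr (Inl n)) (Inr (Inr n))"
  have "emeasure M {\<omega> \<in> space M. waiting_time X Y Z n \<omega> \<le> x} =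
    emeasure M {\<omega> \<in> space M. 0 \<le> x \<and> survives_at (rev [0..<n]) (f (?T n \<omega>)) (g (?T n \<omega>)) \<omega>}"
  proof (rule emeasure_eq_AE)
    show "AE \<omega> in M. \<omega> \<in> {\<omega> \<in> space M. waiting_time X Y Z n \<omega> \<le> x} \<longleftrightarrow>
      \<omega> \<in> {\<omega> \<in> space M. 0 \<le> x \<and> survives_at (rev [0..<n]) (f (?T n \<omega>)) (g (?T n \<omega>)) \<omega>}"
      using nonneg_Y[of 0] by eventually_elim (simp only: waiting_time_le_iff f_def g_def prod.case mem_Collect_eq sum.case)
  qed measurable
  also have "\<dots> = (\<integral>\<^sup>+ \<omega>. of_bool (0 \<le> x) * walk.survival (length (rev [0..<n])) (f (?T n \<omega>), g (?T n \<omega>)) \<partial>M)"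
    by (rule emeasure_survives_random_start[OF emeasure_survives, where Q="\<lambda>_. 0 \<le> x" and f=f and g=g])
       (measurable, auto simp: block_def)
  also have "\<dots> = (\<integral>\<^sup>+ \<omega>. (\<lambda>t. of_bool (0 \<le> x) * walk.survival n (f t, g t)) (?T n \<omega>) \<partial>M)"
    by (simp only: length_rev length_upt diff_zero)
  also have "\<dots> = (\<integral>\<^sup>+ \<omega>. (\<lambda>t. of_bool (0 \<le> x) * walk.survival n (f t, g t)) (?T 1 \<omega>) \<partial>M)"
    by (rule nn_integral_triple_cong[OF _ _ _ _ _ _ ident_coord])
       (simp_all only: of_bool_def sum.inject sum.distinct, measurable)
  finally show ?thesis by (simp only: f_def g_def prod.case sum.case)
qed

end

section \<open>Limit laws and bounds on their tails\<close>

context tandem_queue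
begin

text \<open>
  Survival probabilities decrease in the number of steps, so the distribution functions of \<open>S n\<close>
  decrease in \<open>n\<close> and converge everywhere.
\<close>

lemma limit_law_cdf:
  assumes lim: "limit_law M S \<mu>" and S[measurable]: "\<And>n. S n \<in> borel_measurable M"
    and eq: "\<And>n x. emeasure M {\<omega> \<in> space M. S n \<omega> \<le> x} =
      (\<integral>\<^sup>+ \<omega>. of_bool (Q x \<omega>) * walk.survival n (f x \<omega>, g x \<omega>) \<partial>M)"
    and Q[measurable]: "\<And>x. Measurable.pred M (Q x)"
    and f[measurable]: "\<And>x. f x \<in> borel_measurable M" and g[measurable]: "\<And>x. g x \<in> borel_measurable M"
  shows "ennreal (cdf \<mu> x) = (\<integral>\<^sup>+ \<omega>. of_bool (Q x \<omega>) * walk.eternal_survival (f x \<omega>, g x \<omega>) \<partial>M)"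
    and "(\<lambda>n. measure M {\<omega> \<in> space M. S n \<omega> > x}) \<longlonglongrightarrow> measure \<mu> {x<..}"
    and "measure \<mu> {x<..} = 1 - cdf \<mu> x"
proof -
  have \<mu>: "real_distribution \<mu>" and conv: "weak_conv_m (\<lambda>n. distr M borel (S n)) \<mu>"
    using lim by (auto simp: limit_law_def)
  interpret \<mu>: real_distribution \<mu> by fact
  have cdf: "cdf (distr M borel (S n)) y = measure M {\<omega> \<in> space M. S n \<omega> \<le> y}" for n y
    by (subst cdf_def, subst measure_distr) (auto intro!: arg_cong[where f="measure M"])
  have dec: "decseq (\<lambda>n. cdf (distr M borel (S n)) y)" for y
  proof (rule decseq_SucI)
    fix n
    have "ennreal (cdf (distr M borel (S (Suc n))) y) \<le> ennreal (cdf (distr M borel (S n)) y)"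
      unfolding cdf emeasure_eq_measure[symmetric] eq
      by (intro nn_integral_mono mult_left_mono walk.survival_Suc_le) auto
    then show "cdf (distr M borel (S (Suc n))) y \<le> cdf (distr M borel (S n)) y"
      by (simp add: cdf)
  qed
  have lim: "(\<lambda>n. cdf (distr M borel (S n)) x) \<longlonglongrightarrow> cdf \<mu> x"
    by (rule weak_limit_of_decreasing_cdfs[OF _ \<mu> conv dec]) (auto intro: real_distribution_distr)
  have surv: "walk.survival n \<in> borel_measurable (borel \<Otimes>\<^sub>M borel)" for n
    using walk.measurable_survival by (simp only: borel_prod)
  have esurv: "walk.eternal_survival \<in> borel_measurable (borel \<Otimes>\<^sub>M borel)"
    using walk.measurable_eternal_survival by (simp only: borel_prod)
  note [measurable] = surv esurv
  have "(\<lambda>n. \<integral>\<^sup>+ \<omega>. of_bool (Q x \<omega>) * walk.survival n (f x \<omega>, g x \<omega>) \<partial>M) \<longlonglongrightarrow>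
    (\<integral>\<^sup>+ \<omega>. of_bool (Q x \<omega>) * walk.eternal_survival (f x \<omega>, g x \<omega>) \<partial>M)"
  proof (rule nn_integral_dominated_convergence[where w="\<lambda>_. 1"])
    show "AE \<omega> in M. (\<lambda>n. of_bool (Q x \<omega>) * walk.survival n (f x \<omega>, g x \<omega>)) \<longlonglongrightarrow>
       of_bool (Q x \<omega>) * walk.eternal_survival (f x \<omega>, g x \<omega>)"
      by (intro AE_I2 ennreal_tendsto_cmult walk.survival_tendsto) (simp add: of_bool_def)
    show "AE \<omega> in M. of_bool (Q x \<omega>) * walk.survival n (f x \<omega>, g x \<omega>) \<le> 1" for n
      using walk.survival_le_1 by (simp add: of_bool_def)
    show "(\<lambda>\<omega>. of_bool (Q x \<omega>) * walk.survival n (f x \<omega>, g x \<omega>)) \<in> borel_measurable M" for n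
      unfolding of_bool_def by measurable
    show "(\<lambda>\<omega>. of_bool (Q x \<omega>) * walk.eternal_survival (f x \<omega>, g x \<omega>)) \<in> borel_measurable M"
      unfolding of_bool_def by measurable
  qed (simp_all add: emeasure_space_1)
  moreover have "(\<lambda>n. \<integral>\<^sup>+ \<omega>. of_bool (Q x \<omega>) * walk.survival n (f x \<omega>, g x \<omega>) \<partial>M) \<longlonglongrightarrow> ennreal (cdf \<mu> x)"
    using tendsto_ennrealI[OF lim] unfolding cdf emeasure_eq_measure[symmetric] eq .
  ultimately show "ennreal (cdf \<mu> x) = (\<integral>\<^sup>+ \<omega>. of_bool (Q x \<omega>) * walk.eternal_survival (f x \<omega>, g x \<omega>) \<partial>M)"
    by (rule LIMSEQ_unique[symmetric])
  show tail: "measure \<mu> {x<..} = 1 - cdf \<mu> x"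
  proof -
    have "{x<..} = space \<mu> - {..x}" by auto
    then show ?thesis unfolding cdf_def by (subst \<mu>.prob_compl[symmetric]) auto
  qed
  have "measure M {\<omega> \<in> space M. S n \<omega> > x} = 1 - cdf (distr M borel (S n)) x" for n
  proof -
    have "{\<omega> \<in> space M. S n \<omega> > x} = space M - {\<omega> \<in> space M. S n \<omega> \<le> x}" by auto
    then show ?thesis unfolding cdf by (subst prob_compl[symmetric]) auto
  qed
  then show "(\<lambda>n. measure M {\<omega> \<in> space M. S n \<omega> > x}) \<longlonglongrightarrow> measure \<mu> {x<..}"
    unfolding tail using lim by (auto intro!: tendsto_diff)
qed

lemma tail_lower_bound:
  assumes \<eta>: "\<And>p. 0 \<le> \<eta> p" "\<And>\<omega>. walk.eternal_survival (f \<omega>, g \<omega>) \<le> ennreal (\<eta> (ereal (f \<omega>), ereal (g \<omega>)))"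
    and F: "0 \<le> F" "ennreal F = (\<integral>\<^sup>+ \<omega>. of_bool (Q \<omega>) * walk.eternal_survival (f \<omega>, g \<omega>) \<partial>M)"
  shows "1 - ext_expectation M (\<lambda>\<omega>. of_bool (Q \<omega>) * \<eta> (ereal (f \<omega>), ereal (g \<omega>))) \<le> ereal (1 - F)"
proof -
  have "ereal F = enn2ereal (ennreal F)" using F(1) by simp
  also have "\<dots> \<le> enn2ereal (\<integral>\<^sup>+ \<omega>. ennreal (of_bool (Q \<omega>) * \<eta> (ereal (f \<omega>), ereal (g \<omega>))) \<partial>M)"
    unfolding F(2) less_eq_ennreal.rep_eq[symmetric]
  proof (rule nn_integral_mono)
    show "of_bool (Q \<omega>) * walk.eternal_survival (f \<omega>, g \<omega>) \<le> ennreal (of_bool (Q \<omega>) * \<eta> (ereal (f \<omega>), ereal (g \<omega>)))" for \<omega>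
      using \<eta>(2)[of \<omega>] by (cases "Q \<omega>") (simp_all only: of_bool_eq mult_1 mult_zero_left ennreal_0 order_refl)
  qed
  also have "\<dots> = ext_expectation M (\<lambda>\<omega>. of_bool (Q \<omega>) * \<eta> (ereal (f \<omega>), ereal (g \<omega>)))"
    by (rule ext_expectation_nonneg[symmetric]) (simp add: \<eta>(1))
  finally have "1 - ext_expectation M (\<lambda>\<omega>. of_bool (Q \<omega>) * \<eta> (ereal (f \<omega>), ereal (g \<omega>))) \<le> 1 - ereal F"
    by (intro ereal_minus_mono) auto
  then show ?thesis by (simp add: one_ereal_def)
qed

lemma tail_upper_bound:
  assumes \<gamma>: "\<And>u v. ennreal (\<gamma> (ereal u, ereal v)) \<le> walk.eternal_survival (u, v)"
    and F: "0 \<le> F" "(\<integral>\<^sup>+ \<omega>. of_bool (Q \<omega>) * walk.eternal_survival (f \<omega>, g \<omega>) \<partial>M) \<le> ennreal F"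
  shows "ereal (1 - F) \<le> 1 - ext_expectation M (\<lambda>\<omega>. of_bool (Q \<omega>) * \<gamma> (ereal (f \<omega>), ereal (g \<omega>)))"
proof -
  have "(\<integral>\<^sup>+ \<omega>. ennreal (of_bool (Q \<omega>) * \<gamma> (ereal (f \<omega>), ereal (g \<omega>))) \<partial>M) \<le>
      (\<integral>\<^sup>+ \<omega>. of_bool (Q \<omega>) * walk.eternal_survival (f \<omega>, g \<omega>) \<partial>M)"
  proof (rule nn_integral_mono)
    show "ennreal (of_bool (Q \<omega>) * \<gamma> (ereal (f \<omega>), ereal (g \<omega>))) \<le> of_bool (Q \<omega>) * walk.eternal_survival (f \<omega>, g \<omega>)" for \<omega>
      using \<gamma>[of "f \<omega>" "g \<omega>"] by (cases "Q \<omega>") (simp_all only: of_bool_eq mult_1 mult_zero_left ennreal_0 order_refl)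
  qed
  also note F(2)
  finally have "enn2ereal (\<integral>\<^sup>+ \<omega>. ennreal (of_bool (Q \<omega>) * \<gamma> (ereal (f \<omega>), ereal (g \<omega>))) \<partial>M) \<le> enn2ereal (ennreal F)"
    by (simp only: less_eq_ennreal.rep_eq)
  also have "enn2ereal (ennreal F) = ereal F" using F(1) by simp
  finally have "enn2ereal (\<integral>\<^sup>+ \<omega>. ennreal (of_bool (Q \<omega>) * \<gamma> (ereal (f \<omega>), ereal (g \<omega>))) \<partial>M) \<le> ereal F" .
  with ext_expectation_le have "ext_expectation M (\<lambda>\<omega>. of_bool (Q \<omega>) * \<gamma> (ereal (f \<omega>), ereal (g \<omega>))) \<le> ereal F"
    by (rule order_trans)
  then have "1 - ereal F \<le> 1 - ext_expectation M (\<lambda>\<omega>. of_bool (Q \<omega>) * \<gamma> (ereal (f \<omega>), ereal (g \<omega>)))"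
    by (intro ereal_minus_mono) auto
  then show ?thesis by (simp add: one_ereal_def)
qed

lemma tail_identity:
  assumes [measurable]: "f \<in> borel_measurable M" "g \<in> borel_measurable M" "Measurable.pred M Q"
    and F: "0 \<le> F" "ennreal F = (\<integral>\<^sup>+ \<omega>. of_bool (Q \<omega>) * walk.eternal_survival (f \<omega>, g \<omega>) \<partial>M)"
  shows "1 - F = 1 - (\<integral> \<omega>. of_bool (Q \<omega>) * joint_cdf_T M U V (ereal (f \<omega>), ereal (g \<omega>)) \<partial>M)"
proof -
  have nonneg: "0 \<le> joint_cdf_T M U V p" for p by (simp add: joint_cdf_T_def split: prod.split)
  have eq: "joint_cdf_T M U V (ereal u, ereal v) = enn2real (walk.eternal_survival (u, v))" for u v
    unfolding joint_cdf_T_eq_eternal_survival[symmetric] using nonneg by simp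
  have [measurable]: "walk.eternal_survival \<in> borel_measurable (borel \<Otimes>\<^sub>M borel)"
    using walk.measurable_eternal_survival by (simp only: borel_prod)
  have "(\<integral> \<omega>. of_bool (Q \<omega>) * joint_cdf_T M U V (ereal (f \<omega>), ereal (g \<omega>)) \<partial>M) =
    enn2real (\<integral>\<^sup>+ \<omega>. ennreal (of_bool (Q \<omega>) * joint_cdf_T M U V (ereal (f \<omega>), ereal (g \<omega>))) \<partial>M)"
  proof (rule integral_eq_nn_integral)
    show "(\<lambda>\<omega>. of_bool (Q \<omega>) * joint_cdf_T M U V (ereal (f \<omega>), ereal (g \<omega>))) \<in> borel_measurable M"
      unfolding eq of_bool_def by measurable
  qed (simp add: nonneg)
  also have "(\<integral>\<^sup>+ \<omega>. ennreal (of_bool (Q \<omega>) * joint_cdf_T M U V (ereal (f \<omega>), ereal (g \<omega>))) \<partial>M) = ennreal F"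
    unfolding F(2) by (intro nn_integral_cong) (auto simp: joint_cdf_T_eq_eternal_survival)
  finally show ?thesis using F(1) by simp
qed

end

text \<open>
  Both start states satisfy \<open>u \<le> v\<close>, so \<open>\<psi> \<le> \<eta>\<close> applies at them.
\<close>

theorem corollary2:
  fixes M :: "'a measure"
    and X Y Z U V :: "nat \<Rightarrow> 'a \<Rightarrow> real"
    and W_law D_law :: "real measure"
    and \<psi> \<gamma> \<eta> :: "ereal \<times> ereal \<Rightarrow> real"
    and w d :: "real \<Rightarrow> 'a \<Rightarrow> ereal \<times> ereal"
    and K :: real
  defines "U \<equiv> \<lambda>i \<omega>. Y i \<omega> - X i \<omega>"
    and "V \<equiv> \<lambda>i \<omega>. Z i \<omega> - X i \<omega>"
    and "\<psi> \<equiv> joint_cdf_T M U V"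
    and "w \<equiv> \<lambda>x \<omega>. (ereal (x - max (Z 1 \<omega> - Y 1 \<omega>) 0), ereal (x - (Z 1 \<omega> - Y 1 \<omega>)))"
    and "d \<equiv> \<lambda>x \<omega>. (ereal (x - (Z 1 \<omega> + max (Z 2 \<omega>) (Y 1 \<omega>))), ereal (x - (Z 1 \<omega> + Z 2 \<omega>)))"
  assumes queue: "tandem_queue M X Y Z"
    and W_law: "limit_law M (waiting_time X Y Z) W_law"
    and D_law: "limit_law M (sojourn_time X Y Z) D_law"
    and U_pos: "measure M {\<omega> \<in> space M. U 1 \<omega> > 0} > 0"
    and V_pos: "measure M {\<omega> \<in> space M. V 1 \<omega> > 0} > 0"
    and \<gamma>_borel: "\<gamma> \<in> borel_measurable borel"
    and \<gamma>_le: "\<And>p. \<gamma> p \<le> K"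
    and \<gamma>_infty: "\<gamma> (\<infinity>, \<infinity>) = 1"
    and \<gamma>_limsup: "Limsup (at (\<infinity>, \<infinity>)) (\<lambda>p. ereal (\<gamma> p)) = 1"
    and \<gamma>_drift: "\<And>u v. (u, v) \<in> supp (\<lambda>p. max (\<gamma> p) 0) \<Longrightarrow>
      ext_expectation M (\<lambda>\<omega>. of_bool (u \<ge> ereal (U 1 \<omega>)) *
        \<gamma> (min (u - ereal (U 1 \<omega>)) (v - ereal (V 1 \<omega>)), v - ereal (V 1 \<omega>))) \<ge> ereal (\<gamma> (u, v))"
    and \<eta>_borel: "\<eta> \<in> borel_measurable borel"
    and \<eta>_nonneg: "\<And>p. 0 \<le> \<eta> p"
    and \<eta>_infty: "\<eta> (\<infinity>, \<infinity>) = 1"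
    and \<eta>_liminf: "Liminf (at (\<infinity>, \<infinity>)) (\<lambda>p. ereal (\<eta> p)) = 1"
    and \<eta>_drift: "\<And>u v. (u, v) \<in> supp \<psi> \<Longrightarrow> v \<ge> u \<Longrightarrow>
      ext_expectation M (\<lambda>\<omega>. of_bool (u \<ge> ereal (U 1 \<omega>)) *
        \<eta> (min (u - ereal (U 1 \<omega>)) (v - ereal (V 1 \<omega>)), v - ereal (V 1 \<omega>))) \<le> ereal (\<eta> (u, v))"
  shows "\<forall>x\<ge>0.
      ((\<lambda>n. measure M {\<omega> \<in> space M. waiting_time X Y Z n \<omega> > x}) \<longlonglongrightarrow> measure W_law {x<..} \<and>
        1 - ext_expectation M (\<lambda>\<omega>. \<eta> (w x \<omega>)) \<le> ereal (measure W_law {x<..}) \<and>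
        measure W_law {x<..} = 1 - (\<integral>\<omega>. \<psi> (w x \<omega>) \<partial>M) \<and>
        ereal (measure W_law {x<..}) \<le> 1 - ext_expectation M (\<lambda>\<omega>. \<gamma> (w x \<omega>))) \<and>
      ((\<lambda>n. measure M {\<omega> \<in> space M. sojourn_time X Y Z n \<omega> > x}) \<longlonglongrightarrow> measure D_law {x<..} \<and>
        1 - ext_expectation M (\<lambda>\<omega>. of_bool (Z 1 \<omega> + Y 1 \<omega> \<le> x) * \<eta> (d x \<omega>)) \<le> ereal (measure D_law {x<..}) \<and>
        measure D_law {x<..} = 1 - (\<integral>\<omega>. of_bool (Z 1 \<omega> + Y 1 \<omega> \<le> x) * \<psi> (d x \<omega>) \<partial>M) \<and>
        ereal (measure D_law {x<..}) \<le> 1 - ext_expectation M (\<lambda>\<omega>. of_bool (Z 1 \<omega> + Y 1 \<omega> \<le> x) * \<gamma> (d x \<omega>))) \<and>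
      (measure M {\<omega> \<in> space M. Z 1 \<omega> + Y 1 \<omega> = x} = 0 \<longrightarrow>
        1 - ext_expectation M (\<lambda>\<omega>. of_bool (Z 1 \<omega> + Y 1 \<omega> < x) * \<eta> (d x \<omega>)) \<le> ereal (measure D_law {x<..}) \<and>
        measure D_law {x<..} = 1 - (\<integral>\<omega>. of_bool (Z 1 \<omega> + Y 1 \<omega> < x) * \<psi> (d x \<omega>) \<partial>M)) \<and>
      ereal (measure D_law {x<..}) \<le> 1 - ext_expectation M (\<lambda>\<omega>. of_bool (Z 1 \<omega> + Y 1 \<omega> < x) * \<gamma> (d x \<omega>))"
proof (intro allI impI)
  fix x :: real assume x: "0 \<le> x"
  interpret tandem_queue M X Y Z by (rule queue)
  obtain \<theta> r where "drifting_killed_walk M (\<lambda>\<omega>. Y 1 \<omega> - X 1 \<omega>) (\<lambda>\<omega>. Z 1 \<omega> - X 1 \<omega>) \<theta> r"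
    by (rule drifting_walk)
  then interpret drift: drifting_killed_walk M "\<lambda>\<omega>. Y 1 \<omega> - X 1 \<omega>" "\<lambda>\<omega>. Z 1 \<omega> - X 1 \<omega>" \<theta> r .
  have \<psi>: "ennreal (\<psi> (ereal u, ereal v)) = walk.eternal_survival (u, v)" for u v
    unfolding \<psi>_def U_def V_def by (rule joint_cdf_T_eq_eternal_survival)
  have \<gamma>_le_\<psi>: "ennreal (\<gamma> (ereal u, ereal v)) \<le> walk.eternal_survival (u, v)" for u v
  proof (rule drift.lower_test_function[OF \<gamma>_borel \<gamma>_le])
    fix u v :: real assume "0 < \<gamma> (ereal u, ereal v)"
    then have "(ereal u, ereal v) \<in> supp (\<lambda>p. max (\<gamma> p) 0)" by (simp add: supp_def)
    from \<gamma>_drift[OF this]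
    show "ereal (\<gamma> (ereal u, ereal v)) \<le> ext_expectation M (\<lambda>\<omega>. of_bool (ereal (Y 1 \<omega> - X 1 \<omega>) \<le> ereal u) *
        \<gamma> (min (ereal u - ereal (Y 1 \<omega> - X 1 \<omega>)) (ereal v - ereal (Z 1 \<omega> - X 1 \<omega>)), ereal v - ereal (Z 1 \<omega> - X 1 \<omega>)))"
      unfolding U_def V_def .
  qed (simp add: \<gamma>_limsup)
  have \<psi>_le_\<eta>: "walk.eternal_survival (u, v) \<le> ennreal (\<eta> (ereal u, ereal v))" if "u \<le> v" for u v
  proof (rule drift.upper_test_function[OF \<eta>_borel \<eta>_nonneg _ _ that])
    fix u v :: real assume uv: "walk.eternal_survival (u, v) \<noteq> 0" "u \<le> v"
    then have "(ereal u, ereal v) \<in> supp \<psi>" using \<psi>[of u v] by (auto simp: supp_def)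
    from \<eta>_drift[OF this] uv(2)
    show "ext_expectation M (\<lambda>\<omega>. of_bool (ereal (Y 1 \<omega> - X 1 \<omega>) \<le> ereal u) *
        \<eta> (min (ereal u - ereal (Y 1 \<omega> - X 1 \<omega>)) (ereal v - ereal (Z 1 \<omega> - X 1 \<omega>)), ereal v - ereal (Z 1 \<omega> - X 1 \<omega>)))
      \<le> ereal (\<eta> (ereal u, ereal v))"
      unfolding U_def V_def by simp
  qed (simp add: \<eta>_liminf)

  let ?fw = "\<lambda>x \<omega>. x - max (Z 1 \<omega> - Y 1 \<omega>) 0" and ?gw = "\<lambda>x \<omega>. x - (Z 1 \<omega> - Y 1 \<omega>)"
  let ?fd = "\<lambda>x \<omega>. x - (Z 1 \<omega> + max (Z 2 \<omega>) (Y 1 \<omega>))" and ?gd = "\<lambda>x \<omega>. x - (Z 1 \<omega> + Z 2 \<omega>)"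
  let ?Q = "\<lambda>x \<omega>. Z 1 \<omega> + Y 1 \<omega> \<le> x" and ?Q' = "\<lambda>x \<omega>. Z 1 \<omega> + Y 1 \<omega> < x"
  have ordw: "?fw x \<omega> \<le> ?gw x \<omega>" and ordd: "?fd x \<omega> \<le> ?gd x \<omega>" for \<omega> by auto
  interpret W: real_distribution W_law using W_law by (simp add: limit_law_def)
  interpret D: real_distribution D_law using D_law by (simp add: limit_law_def)
  note Wlim = limit_law_cdf[OF W_law measurable_waiting_time emeasure_waiting_time_le]
  note Dlim = limit_law_cdf[OF D_law measurable_sojourn_time emeasure_sojourn_time_le]
  have FW: "ennreal (cdf W_law x) = (\<integral>\<^sup>+ \<omega>. of_bool True * walk.eternal_survival (?fw x \<omega>, ?gw x \<omega>) \<partial>M)"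
  proof -
    have "ennreal (cdf W_law x) = (\<integral>\<^sup>+ \<omega>. of_bool (0 \<le> x) * walk.eternal_survival (?fw x \<omega>, ?gw x \<omega>) \<partial>M)"
      by (rule Wlim(1)) measurable
    then show ?thesis by (simp only: x)
  qed
  have FD: "ennreal (cdf D_law x) = (\<integral>\<^sup>+ \<omega>. of_bool (?Q x \<omega>) * walk.eternal_survival (?fd x \<omega>, ?gd x \<omega>) \<partial>M)"
    by (rule Dlim(1)) measurable
  \<comment> \<open>Passing to the strict inequality can only decrease the expectation of \<open>\<psi>\<close>, so the bound by \<open>\<gamma>\<close> persists.\<close>
  have "(\<integral>\<^sup>+ \<omega>. of_bool (?Q' x \<omega>) * walk.eternal_survival (?fd x \<omega>, ?gd x \<omega>) \<partial>M) \<le> ennreal (cdf D_law x)"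
    unfolding FD by (intro nn_integral_mono mult_right_mono) auto
  note upper' = tail_upper_bound[OF \<gamma>_le_\<psi> D.cdf_nonneg this]
  have FD': "ennreal (cdf D_law x) = (\<integral>\<^sup>+ \<omega>. of_bool (?Q' x \<omega>) * walk.eternal_survival (?fd x \<omega>, ?gd x \<omega>) \<partial>M)"
    if "measure M {\<omega> \<in> space M. Z 1 \<omega> + Y 1 \<omega> = x} = 0"
  proof -
    have "AE \<omega> in M. \<not> (Z 1 \<omega> + Y 1 \<omega> = x)"
      using that by (intro AE_I'[of "{\<omega> \<in> space M. Z 1 \<omega> + Y 1 \<omega> = x}"]) (auto simp: emeasure_eq_measure null_sets_def)
    then have "AE \<omega> in M. of_bool (?Q x \<omega>) * walk.eternal_survival (?fd x \<omega>, ?gd x \<omega>) =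
        of_bool (?Q' x \<omega>) * walk.eternal_survival (?fd x \<omega>, ?gd x \<omega>)"
      by eventually_elim (simp only: order.strict_iff_order simp_thms)
    then show ?thesis unfolding FD by (rule nn_integral_cong_AE)
  qed
  show "((\<lambda>n. measure M {\<omega> \<in> space M. waiting_time X Y Z n \<omega> > x}) \<longlonglongrightarrow> measure W_law {x<..} \<and>
        1 - ext_expectation M (\<lambda>\<omega>. \<eta> (w x \<omega>)) \<le> ereal (measure W_law {x<..}) \<and>
        measure W_law {x<..} = 1 - (\<integral>\<omega>. \<psi> (w x \<omega>) \<partial>M) \<and>
        ereal (measure W_law {x<..}) \<le> 1 - ext_expectation M (\<lambda>\<omega>. \<gamma> (w x \<omega>))) \<and>
      ((\<lambda>n. measure M {\<omega> \<in> space M. sojourn_time X Y Z n \<omega> > x}) \<longlonglongrightarrow> measure D_law {x<..} \<and>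
        1 - ext_expectation M (\<lambda>\<omega>. of_bool (Z 1 \<omega> + Y 1 \<omega> \<le> x) * \<eta> (d x \<omega>)) \<le> ereal (measure D_law {x<..}) \<and>
        measure D_law {x<..} = 1 - (\<integral>\<omega>. of_bool (Z 1 \<omega> + Y 1 \<omega> \<le> x) * \<psi> (d x \<omega>) \<partial>M) \<and>
        ereal (measure D_law {x<..}) \<le> 1 - ext_expectation M (\<lambda>\<omega>. of_bool (Z 1 \<omega> + Y 1 \<omega> \<le> x) * \<gamma> (d x \<omega>))) \<and>
      (measure M {\<omega> \<in> space M. Z 1 \<omega> + Y 1 \<omega> = x} = 0 \<longrightarrow>
        1 - ext_expectation M (\<lambda>\<omega>. of_bool (Z 1 \<omega> + Y 1 \<omega> < x) * \<eta> (d x \<omega>)) \<le> ereal (measure D_law {x<..}) \<and>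
        measure D_law {x<..} = 1 - (\<integral>\<omega>. of_bool (Z 1 \<omega> + Y 1 \<omega> < x) * \<psi> (d x \<omega>) \<partial>M)) \<and>
      ereal (measure D_law {x<..}) \<le> 1 - ext_expectation M (\<lambda>\<omega>. of_bool (Z 1 \<omega> + Y 1 \<omega> < x) * \<gamma> (d x \<omega>))"
  proof (intro conjI impI)
    have tW: "measure W_law {x<..} = 1 - cdf W_law x" by (rule Wlim(3)) measurable
    have tD: "measure D_law {x<..} = 1 - cdf D_law x" by (rule Dlim(3)) measurable
    show "(\<lambda>n. measure M {\<omega> \<in> space M. waiting_time X Y Z n \<omega> > x}) \<longlonglongrightarrow> measure W_law {x<..}"
      by (rule Wlim(2)) measurable
    show "(\<lambda>n. measure M {\<omega> \<in> space M. sojourn_time X Y Z n \<omega> > x}) \<longlonglongrightarrow> measure D_law {x<..}"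
      by (rule Dlim(2)) measurable
    show "1 - ext_expectation M (\<lambda>\<omega>. \<eta> (w x \<omega>)) \<le> ereal (measure W_law {x<..})"
      using tail_lower_bound[OF \<eta>_nonneg \<psi>_le_\<eta>[OF ordw] W.cdf_nonneg FW] unfolding tW w_def by (simp only: of_bool_eq mult_1)
    show "measure W_law {x<..} = 1 - (\<integral>\<omega>. \<psi> (w x \<omega>) \<partial>M)"
    proof -
      have "1 - cdf W_law x = 1 - (\<integral> \<omega>. of_bool True * joint_cdf_T M (\<lambda>i \<omega>. Y i \<omega> - X i \<omega>) (\<lambda>i \<omega>. Z i \<omega> - X i \<omega>) (ereal (?fw x \<omega>), ereal (?gw x \<omega>)) \<partial>M)"
        by (rule tail_identity[OF _ _ _ W.cdf_nonneg FW]) measurable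
      then show ?thesis unfolding tW w_def \<psi>_def U_def V_def by (simp only: of_bool_eq mult_1)
    qed
    show "ereal (measure W_law {x<..}) \<le> 1 - ext_expectation M (\<lambda>\<omega>. \<gamma> (w x \<omega>))"
      using tail_upper_bound[OF \<gamma>_le_\<psi> W.cdf_nonneg eq_refl[OF FW[symmetric]]] unfolding tW w_def by (simp only: of_bool_eq mult_1)
    show "1 - ext_expectation M (\<lambda>\<omega>. of_bool (Z 1 \<omega> + Y 1 \<omega> \<le> x) * \<eta> (d x \<omega>)) \<le> ereal (measure D_law {x<..})"
      using tail_lower_bound[OF \<eta>_nonneg \<psi>_le_\<eta>[OF ordd] D.cdf_nonneg FD] unfolding tD d_def .
    show "measure D_law {x<..} = 1 - (\<integral>\<omega>. of_bool (Z 1 \<omega> + Y 1 \<omega> \<le> x) * \<psi> (d x \<omega>) \<partial>M)"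
      unfolding tD d_def \<psi>_def U_def V_def by (rule tail_identity[OF _ _ _ D.cdf_nonneg FD]) measurable
    show "ereal (measure D_law {x<..}) \<le> 1 - ext_expectation M (\<lambda>\<omega>. of_bool (Z 1 \<omega> + Y 1 \<omega> \<le> x) * \<gamma> (d x \<omega>))"
      using tail_upper_bound[OF \<gamma>_le_\<psi> D.cdf_nonneg eq_refl[OF FD[symmetric]]] unfolding tD d_def .
    assume null: "measure M {\<omega> \<in> space M. Z 1 \<omega> + Y 1 \<omega> = x} = 0"
    show "1 - ext_expectation M (\<lambda>\<omega>. of_bool (Z 1 \<omega> + Y 1 \<omega> < x) * \<eta> (d x \<omega>)) \<le> ereal (measure D_law {x<..})"
      using tail_lower_bound[OF \<eta>_nonneg \<psi>_le_\<eta>[OF ordd] D.cdf_nonneg FD'[OF null]] unfolding tD d_def .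
    show "measure D_law {x<..} = 1 - (\<integral>\<omega>. of_bool (Z 1 \<omega> + Y 1 \<omega> < x) * \<psi> (d x \<omega>) \<partial>M)"
      unfolding tD d_def \<psi>_def U_def V_def by (rule tail_identity[OF _ _ _ D.cdf_nonneg FD'[OF null]]) measurable
  next
    have tD: "measure D_law {x<..} = 1 - cdf D_law x" by (rule Dlim(3)) measurable
    show "ereal (measure D_law {x<..}) \<le> 1 - ext_expectation M (\<lambda>\<omega>. of_bool (Z 1 \<omega> + Y 1 \<omega> < x) * \<gamma> (d x \<omega>))"
      using upper' unfolding tD d_def .
  qed
qed

end
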